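(* Let $n\ge1$. Consider the function sum: Alice has $X\in\{0,1\}^n$, Bob has $Y\in\{0,1\}^n$, and Charlie outputs $Z=X+Y\in\{0,1,2\}^n$ (component-wise integer sum). For every $p_{XY}$ with full support on $\{0,1\}^n\times\{0,1\}^n$, any secure protocol satisfies \[H(M_{31})\ge n\log 3,\quad H(M_{23})\ge n\log3,\quad H(M_{12})\ge 1.5\,n,\] and $\rho(p_{XY},\text{sum})\ge n\log 3$.
   Context: Setting: Alice (party 1) holds $X$, Bob (party 2) holds $Y$, $(X,Y)\sim p_{XY}$ on finite sets; Charlie (party 3) has no input and outputs $Z$, which should equal $f(X,Y)$ for the deterministic function $f$. In a protocol the parties, each with private randomness, exchange messages over multiple rounds on three pairwise private links, each message a codeword of a prefix-free code determined by previous messages on that link; the protocol terminates with probability 1 and may depend on $p_{XY}$. $M_{12},M_{23},M_{31}$ are the final transcripts on the Alice–Bob, Bob–Charlie, Charlie–Alice links; the view $V_i$ of party $i$ consists of the transcripts on its two links plus its input (Alice, Bob) or output (Charlie). A secure protocol satisfies correctness (Charlie outputs $f(x,y)$ on inputs $x,y$) and privacy (Markov chains $(M_{12},M_{31})-X-(Y,Z)$, $(M_{12},M_{23})-Y-(X,Z)$, $(M_{23},M_{31})-Z-(X,Y)$). $\rho(p_{XY},f)=\inf H(V_1,V_2,V_3|X,Y)$ over all secure protocols for $f$ with input distribution $p_{XY}$. Logs base 2. *)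

theory Defs
  imports "HOL-Probability.Probability" "HOL-Library.Sublist"
begin

text \<open>A link history is the list of rounds on that link; in each round a pair of
messages (one per direction).  Conventions:
  link 12: (Alice to Bob, Bob to Alice);
  link 23: (Bob to Charlie, Charlie to Bob);
  link 31: (Charlie to Alice, Alice to Charlie).
The code used for the next message in a given direction is determined by the previous
messages on that link (the history).  A code equal to the singleton of the empty word
means that nothing is sent in that round.  Private randomness is modelled by letting
each party draw its round messages from a distribution depending on its input and the
messages seen so far on its two links (behavioural randomisation).\<close>

type_synonym hist = "(bool list \<times> bool list) list"

record ('a, 'b, 'c) protocol =
  cA2B :: "hist \<Rightarrow> bool list set"
  cB2A :: "hist \<Rightarrow> bool list set"
  cB2C :: "hist \<Rightarrow> bool list set"
  cC2B :: "hist \<Rightarrow> bool list set"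
  cC2A :: "hist \<Rightarrow> bool list set"
  cA2C :: "hist \<Rightarrow> bool list set"
  kA :: "'a \<Rightarrow> hist \<Rightarrow> hist \<Rightarrow> (bool list \<times> bool list) pmf"
    \<comment> \<open>input, h12, h31 ; returns (to Bob, to Charlie)\<close>
  kB :: "'b \<Rightarrow> hist \<Rightarrow> hist \<Rightarrow> (bool list \<times> bool list) pmf"
    \<comment> \<open>input, h12, h23 ; returns (to Alice, to Charlie)\<close>
  kC :: "hist \<Rightarrow> hist \<Rightarrow> (bool list \<times> bool list) pmf"
    \<comment> \<open>h23, h31 ; returns (to Bob, to Alice)\<close>
  outC :: "bool list \<Rightarrow> bool list \<Rightarrow> 'c pmf"
    \<comment> \<open>Charlie's output given final transcripts M23, M31\<close>

definition prefix_free :: "bool list set \<Rightarrow> bool" where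
  "prefix_free C \<longleftrightarrow> (\<forall>u\<in>C. \<forall>v\<in>C. prefix u v \<longrightarrow> u = v)"

definition valid_protocol :: "('a, 'b, 'c) protocol \<Rightarrow> bool" where
  "valid_protocol P \<longleftrightarrow>
     (\<forall>h. \<forall>C \<in> {cA2B P h, cB2A P h, cB2C P h, cC2B P h, cC2A P h, cA2C P h}.
            C \<noteq> {} \<and> prefix_free C) \<and>
     (\<forall>x h12 h31. set_pmf (kA P x h12 h31) \<subseteq> cA2B P h12 \<times> cA2C P h31) \<and>
     (\<forall>y h12 h23. set_pmf (kB P y h12 h23) \<subseteq> cB2A P h12 \<times> cB2C P h23) \<and>
     (\<forall>h23 h31. set_pmf (kC P h23 h31) \<subseteq> cC2B P h23 \<times> cC2A P h31)"

primrec state :: "('a, 'b, 'c) protocol \<Rightarrow> 'a \<Rightarrow> 'b \<Rightarrow> nat \<Rightarrow> (hist \<times> hist \<times> hist) pmf" where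
  "state P x y 0 = return_pmf ([], [], [])"
| "state P x y (Suc t) = bind_pmf (state P x y t) (\<lambda>(h12, h23, h31).
     bind_pmf (kA P x h12 h31) (\<lambda>(a2b, a2c).
     bind_pmf (kB P y h12 h23) (\<lambda>(b2a, b2c).
     map_pmf (\<lambda>(c2b, c2a). (h12 @ [(a2b, b2a)], h23 @ [(b2c, c2b)], h31 @ [(c2a, a2c)]))
             (kC P h23 h31))))"

definition flat :: "hist \<Rightarrow> bool list" where
  "flat h = concat (map (\<lambda>(u, v). u @ v) h)"

definition strs :: "hist \<times> hist \<times> hist \<Rightarrow> bool list \<times> bool list \<times> bool list" where
  "strs s = (case s of (h12, h23, h31) \<Rightarrow> (flat h12, flat h23, flat h31))"

definition quiet :: "(hist \<Rightarrow> bool list set) \<Rightarrow> (hist \<Rightarrow> bool list set) \<Rightarrow> hist \<Rightarrow> bool" where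
  "quiet c1 c2 h \<longleftrightarrow> (\<forall>k. c1 (h @ replicate k ([], [])) = {[]} \<and> c2 (h @ replicate k ([], [])) = {[]})"

definition terminated :: "('a, 'b, 'c) protocol \<Rightarrow> hist \<times> hist \<times> hist \<Rightarrow> bool" where
  "terminated P s = (case s of (h12, h23, h31) \<Rightarrow>
     quiet (cA2B P) (cB2A P) h12 \<and> quiet (cB2C P) (cC2B P) h23 \<and> quiet (cC2A P) (cA2C P) h31)"

definition terminates :: "('a, 'b, 'c) protocol \<Rightarrow> ('a \<times> 'b) pmf \<Rightarrow> bool" where
  "terminates P p \<longleftrightarrow> (\<forall>(x, y) \<in> set_pmf p.
     (\<lambda>t. measure_pmf.prob (state P x y t) {s. terminated P s}) \<longlonglongrightarrow> 1)"

definition outm :: "('a, 'b, 'c) protocol \<Rightarrow> 'a \<Rightarrow> 'b \<Rightarrow>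
    bool list \<times> bool list \<times> bool list \<times> 'c \<Rightarrow> real" where
  "outm P x y r = (case r of (m12, m23, m31, z) \<Rightarrow>
     lim (\<lambda>t. measure_pmf.prob (state P x y t) {s. terminated P s \<and> strs s = (m12, m23, m31)})
     * pmf (outC P m23 m31) z)"

definition out :: "('a, 'b, 'c) protocol \<Rightarrow> 'a \<Rightarrow> 'b \<Rightarrow> (bool list \<times> bool list \<times> bool list \<times> 'c) pmf" where
  "out P x y = embed_pmf (outm P x y)"

type_synonym ('a, 'b, 'c) outcome = "('a \<times> 'b) \<times> (bool list \<times> bool list \<times> bool list \<times> 'c)"

definition J :: "('a, 'b, 'c) protocol \<Rightarrow> ('a \<times> 'b) pmf \<Rightarrow> ('a, 'b, 'c) outcome pmf" where
  "J P p = bind_pmf p (\<lambda>xy. map_pmf (\<lambda>r. (xy, r)) (out P (fst xy) (snd xy)))"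

definition RX :: "('a, 'b, 'c) outcome \<Rightarrow> 'a" where "RX w = fst (fst w)"
definition RY :: "('a, 'b, 'c) outcome \<Rightarrow> 'b" where "RY w = snd (fst w)"
definition M12 :: "('a, 'b, 'c) outcome \<Rightarrow> bool list" where "M12 w = fst (snd w)"
definition M23 :: "('a, 'b, 'c) outcome \<Rightarrow> bool list" where "M23 w = fst (snd (snd w))"
definition M31 :: "('a, 'b, 'c) outcome \<Rightarrow> bool list" where "M31 w = fst (snd (snd (snd w)))"
definition RZ :: "('a, 'b, 'c) outcome \<Rightarrow> 'c" where "RZ w = snd (snd (snd (snd w)))"

definition V1 where "V1 w = (RX w, M12 w, M31 w)"
definition V2 where "V2 w = (RY w, M12 w, M23 w)"
definition V3 where "V3 w = (M23 w, M31 w, RZ w)"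

definition markov :: "'w pmf \<Rightarrow> ('w \<Rightarrow> 'u) \<Rightarrow> ('w \<Rightarrow> 'v) \<Rightarrow> ('w \<Rightarrow> 't) \<Rightarrow> bool" where
  "markov q A B C \<longleftrightarrow> (\<forall>a b c.
     measure_pmf.prob q {w. A w = a \<and> B w = b \<and> C w = c} * measure_pmf.prob q {w. B w = b}
     = measure_pmf.prob q {w. A w = a \<and> B w = b} * measure_pmf.prob q {w. B w = b \<and> C w = c})"

definition secure :: "('a, 'b, 'c) protocol \<Rightarrow> ('a \<times> 'b) pmf \<Rightarrow> ('a \<Rightarrow> 'b \<Rightarrow> 'c) \<Rightarrow> bool" where
  "secure P p f \<longleftrightarrow> valid_protocol P \<and> terminates P p \<and>
     (\<forall>(x, y) \<in> set_pmf p. \<forall>r \<in> set_pmf (out P x y). snd (snd (snd r)) = f x y) \<and>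
     markov (J P p) (\<lambda>w. (M12 w, M31 w)) RX (\<lambda>w. (RY w, RZ w)) \<and>
     markov (J P p) (\<lambda>w. (M12 w, M23 w)) RY (\<lambda>w. (RX w, RZ w)) \<and>
     markov (J P p) (\<lambda>w. (M23 w, M31 w)) RZ (\<lambda>w. (RX w, RY w))"

definition ent :: "'v pmf \<Rightarrow> ennreal" where
  "ent q = (\<integral>\<^sup>+ v. ennreal (- pmf q v * log 2 (pmf q v)) \<partial>count_space UNIV)"

definition cond_ent :: "'w pmf \<Rightarrow> ('w \<Rightarrow> 'u) \<Rightarrow> ('w \<Rightarrow> 'v) \<Rightarrow> ennreal" where
  "cond_ent q A B = (\<integral>\<^sup>+ b. ennreal (measure_pmf.prob q {w. B w = b})
       * ent (map_pmf A (cond_pmf q {w. B w = b})) \<partial>count_space UNIV)"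

definition rho :: "('a \<times> 'b) pmf \<Rightarrow> ('a \<Rightarrow> 'b \<Rightarrow> 'c) \<Rightarrow> ennreal" where
  "rho p f = (INF P \<in> {P :: ('a, 'b, 'c) protocol. secure P p f}.
       cond_ent (J P p) (\<lambda>w. (V1 w, V2 w, V3 w)) (\<lambda>w. (RX w, RY w)))"

definition sumf :: "bool list \<Rightarrow> bool list \<Rightarrow> nat list" where
  "sumf x y = map2 (\<lambda>a b. of_bool a + of_bool b) x y"

end

theory Submission
  imports Defs
begin

text \<open>
  By privacy each transcript has the same law for all inputs, since on the full support any two
  input pairs are linked by steps that keep \<open>x\<close>, \<open>y\<close> or the sum; so entropies of single transcripts
  may be computed for any input distribution.  \<open>M\<^sub>2\<^sub>3\<close> and \<open>M\<^sub>3\<^sub>1\<close> determine \<open>Z\<close> and each of them is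
  independent of \<open>Z\<close>; taking \<open>Z\<close> uniform on ternary words gives \<open>H(M\<^sub>3\<^sub>1) \<ge> H(Z|M\<^sub>2\<^sub>3) = n log 3\<close>, and the
  bound on \<open>\<rho>\<close> follows because \<open>M\<^sub>3\<^sub>1\<close> is independent of the inputs.

  For \<open>M\<^sub>1\<^sub>2\<close> take independent uniform inputs.  Messages of one party depend only on that party's
  input and its two links, so by induction on rounds
  \<open>I(M\<^sub>1\<^sub>2;M\<^sub>2\<^sub>3|M\<^sub>3\<^sub>1) \<le> I(M\<^sub>1\<^sub>2;M\<^sub>2\<^sub>3)\<close>, that is,
  \<open>H(M\<^sub>1\<^sub>2|M\<^sub>3\<^sub>1) + H(M\<^sub>1\<^sub>2|M\<^sub>2\<^sub>3) \<le> H(M\<^sub>1\<^sub>2) + H(M\<^sub>1\<^sub>2|M\<^sub>2\<^sub>3,M\<^sub>3\<^sub>1)\<close>.  By cut and paste \<open>M\<^sub>1\<^sub>2\<close> and \<open>M\<^sub>3\<^sub>1\<close>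
  determine \<open>X\<close>, and \<open>M\<^sub>1\<^sub>2\<close> and \<open>M\<^sub>2\<^sub>3\<close> determine \<open>Y\<close>, so the left-hand side is at least
  \<open>2n + H(M\<^sub>1\<^sub>2|X,M\<^sub>3\<^sub>1)\<close>, while \<open>H(M\<^sub>1\<^sub>2|M\<^sub>2\<^sub>3,M\<^sub>3\<^sub>1) \<le> H(X|Z) + H(M\<^sub>1\<^sub>2|X,M\<^sub>3\<^sub>1)\<close> with \<open>H(X|Z) = n/2\<close>.
\<close>

section \<open>Surprisal and conditional entropy\<close>

text \<open>The probability of the fibre of \<open>A\<close> through a sample point. Attaching it to
  the point rather than to a value of \<open>A\<close> lets variables with different ranges be
  compared pointwise on one sample space.\<close>

definition atom :: "'w pmf \<Rightarrow> ('w \<Rightarrow> 'u) \<Rightarrow> 'w \<Rightarrow> real" where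
  "atom q A w = measure_pmf.prob q {v. A v = A w}"

definition surprisal :: "'w pmf \<Rightarrow> ('w \<Rightarrow> 'u) \<Rightarrow> 'w \<Rightarrow> real" where
  "surprisal q A w = - log 2 (atom q A w)"

text \<open>On the support this is -log P(A|B) at the sample point. As a difference of surprisals it
  turns chain rules into linear identities that hold before integration.\<close>

definition cond_surprisal :: "'w pmf \<Rightarrow> ('w \<Rightarrow> 'u) \<Rightarrow> ('w \<Rightarrow> 'v) \<Rightarrow> 'w \<Rightarrow> real" where
  "cond_surprisal q A B w = surprisal q (\<lambda>v. (A v, B v)) w - surprisal q B w"

text \<open>H(A|B) with values in the extended reals; conditioning on the constant
  \<open>\<lambda>_. ()\<close> gives H(A).\<close>

definition cond_entropy :: "'w pmf \<Rightarrow> ('w \<Rightarrow> 'u) \<Rightarrow> ('w \<Rightarrow> 'v) \<Rightarrow> ennreal" where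
  "cond_entropy q A B = (\<integral>\<^sup>+ w. ennreal (cond_surprisal q A B w) \<partial>measure_pmf q)"

definition determines :: "'w pmf \<Rightarrow> ('w \<Rightarrow> 'u) \<Rightarrow> ('w \<Rightarrow> 'v) \<Rightarrow> bool" where
  "determines q A B \<longleftrightarrow> (\<forall>v\<in>set_pmf q. \<forall>w\<in>set_pmf q. A v = A w \<longrightarrow> B v = B w)"

text \<open>\<open>0 \<le> E[D]\<close> for a \<open>D\<close> that need not be integrable: transcripts may have infinite entropy.\<close>

definition nonneg_mean :: "'w pmf \<Rightarrow> ('w \<Rightarrow> real) \<Rightarrow> bool" where
  "nonneg_mean q D \<longleftrightarrow> (\<exists>g. integrable (measure_pmf q) g \<and>
     0 \<le> measure_pmf.expectation q g \<and> (\<forall>w\<in>set_pmf q. g w \<le> D w))"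

lemma prob_mono_support:
  assumes "\<And>v. v \<in> set_pmf q \<Longrightarrow> v \<in> S \<Longrightarrow> v \<in> T"
  shows "measure_pmf.prob q S \<le> measure_pmf.prob q T"
  by (rule measure_pmf.finite_measure_mono_AE) (auto simp: AE_measure_pmf_iff assms)

lemma prob_cong_support:
  assumes "\<And>v. v \<in> set_pmf q \<Longrightarrow> v \<in> S \<longleftrightarrow> v \<in> T"
  shows "measure_pmf.prob q S = measure_pmf.prob q T"
  by (rule measure_pmf.finite_measure_eq_AE) (auto simp: AE_measure_pmf_iff assms)

lemma atom_pos: "w \<in> set_pmf q \<Longrightarrow> 0 < atom q A w"
  unfolding atom_def by (rule measure_pmf_posI[of w]) auto

lemma atom_le_1: "atom q A w \<le> 1"
  by (simp add: atom_def)

lemma determinesI: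
  "(\<And>v w. v \<in> set_pmf q \<Longrightarrow> w \<in> set_pmf q \<Longrightarrow> A v = A w \<Longrightarrow> B v = B w) \<Longrightarrow> determines q A B"
  unfolding determines_def by blast

lemma determinesD:
  "determines q A B \<Longrightarrow> v \<in> set_pmf q \<Longrightarrow> w \<in> set_pmf q \<Longrightarrow> A v = A w \<Longrightarrow> B v = B w"
  unfolding determines_def by blast

lemma determines_Pair:
  "determines q A B \<Longrightarrow> determines q A C \<Longrightarrow> determines q A (\<lambda>v. (B v, C v))"
  unfolding determines_def by blast

lemma determines_fst: "determines q (\<lambda>v. (A v, B v)) A"
  and determines_snd: "determines q (\<lambda>v. (A v, B v)) B"
  by (auto simp: determines_def)

lemma determines_trans: "determines q A B \<Longrightarrow> determines q B C \<Longrightarrow> determines q A C"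
  unfolding determines_def by blast

lemma atom_mono:
  assumes "determines q A B" "w \<in> set_pmf q"
  shows "atom q A w \<le> atom q B w"
  unfolding atom_def using assms by (intro prob_mono_support CollectI determinesD[of q A B]) auto

lemma determines_refl [simp]: "determines q A A"
  by (simp add: determines_def)

lemma surprisal_nonneg: "w \<in> set_pmf q \<Longrightarrow> 0 \<le> surprisal q A w"
  using atom_pos[of w q A] atom_le_1[of q A w] by (simp add: surprisal_def)

lemma surprisal_mono:
  assumes "determines q A B" "w \<in> set_pmf q"
  shows "surprisal q B w \<le> surprisal q A w"
  using atom_mono[OF assms] atom_pos[OF assms(2), of A] atom_pos[OF assms(2), of B]
  by (simp add: surprisal_def log_le_cancel_iff)

lemma surprisal_cong:
  assumes "determines q A B" "determines q B A" "w \<in> set_pmf q"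
  shows "surprisal q A w = surprisal q B w"
  by (rule antisym) (rule surprisal_mono[OF assms(2,3)], rule surprisal_mono[OF assms(1,3)])

lemma cond_surprisal_nonneg: "w \<in> set_pmf q \<Longrightarrow> 0 \<le> cond_surprisal q A B w"
  using surprisal_mono[OF determines_snd, of w q B A] by (simp add: cond_surprisal_def)

lemma cond_surprisal_const: "w \<in> set_pmf q \<Longrightarrow> cond_surprisal q A (\<lambda>_. ()) w = surprisal q A w"
  using surprisal_cong[of q "\<lambda>v. (A v, ())" A w]
  by (simp add: cond_surprisal_def surprisal_def[of q "\<lambda>_. ()"] atom_def[of q "\<lambda>_. ()"] determines_def)

lemma cond_surprisal_chain:
  assumes "w \<in> set_pmf q"
  shows "cond_surprisal q (\<lambda>v. (A v, U v)) B w = cond_surprisal q A B w + cond_surprisal q U (\<lambda>v. (A v, B v)) w"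
  using surprisal_cong[of q "\<lambda>v. ((A v, U v), B v)" "\<lambda>v. (U v, A v, B v)" w] assms
  by (simp add: cond_surprisal_def determines_def)

lemma cond_surprisal_mono:
  assumes "w \<in> set_pmf q" "determines q (\<lambda>v. (A' v, B v)) A"
  shows "cond_surprisal q A B w \<le> cond_surprisal q A' B w"
  using surprisal_mono[OF determines_Pair[OF assms(2) determines_snd] assms(1)] by (simp add: cond_surprisal_def)

lemma cond_entropy_mono_point:
  assumes "\<And>w. w \<in> set_pmf q \<Longrightarrow> cond_surprisal q A B w \<le> f w"
  shows "cond_entropy q A B \<le> (\<integral>\<^sup>+ w. ennreal (f w) \<partial>measure_pmf q)"
  unfolding cond_entropy_def using assms by (intro nn_integral_mono_AE) (auto simp: AE_measure_pmf_iff intro!: ennreal_leI)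

lemma cond_entropy_mono:
  assumes "determines q (\<lambda>v. (A' v, B v)) A"
  shows "cond_entropy q A B \<le> cond_entropy q A' B"
  using cond_entropy_mono_point[of q A B "cond_surprisal q A' B"] cond_surprisal_mono[OF _ assms] by (simp add: cond_entropy_def[of q A'])

lemma nn_integral_cond_surprisal_add:
  "(\<integral>\<^sup>+ w. ennreal (cond_surprisal q A B w + cond_surprisal q A' B' w) \<partial>measure_pmf q) = cond_entropy q A B + cond_entropy q A' B'"
proof -
  have "(\<integral>\<^sup>+ w. ennreal (cond_surprisal q A B w + cond_surprisal q A' B' w) \<partial>measure_pmf q) =
      (\<integral>\<^sup>+ w. ennreal (cond_surprisal q A B w) + ennreal (cond_surprisal q A' B' w) \<partial>measure_pmf q)"
    by (intro nn_integral_cong_AE) (auto simp: AE_measure_pmf_iff cond_surprisal_nonneg)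
  then show ?thesis by (simp add: nn_integral_add cond_entropy_def)
qed

lemma cond_entropy_chain: "cond_entropy q (\<lambda>v. (A v, U v)) B = cond_entropy q A B + cond_entropy q U (\<lambda>v. (A v, B v))"
proof -
  have "cond_entropy q (\<lambda>v. (A v, U v)) B =
      (\<integral>\<^sup>+ w. ennreal (cond_surprisal q A B w + cond_surprisal q U (\<lambda>v. (A v, B v)) w) \<partial>measure_pmf q)"
    unfolding cond_entropy_def
    by (intro nn_integral_cong_AE) (simp add: AE_measure_pmf_iff cond_surprisal_chain)
  then show ?thesis by (simp only: nn_integral_cond_surprisal_add)
qed

lemma cond_entropy_const_value:
  assumes "\<And>w. w \<in> set_pmf q \<Longrightarrow> cond_surprisal q A B w = r"
  shows "cond_entropy q A B = ennreal r"
proof -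
  have "cond_entropy q A B = (\<integral>\<^sup>+ w. ennreal r \<partial>measure_pmf q)"
    unfolding cond_entropy_def using assms by (intro nn_integral_cong_AE) (auto simp: AE_measure_pmf_iff)
  then show ?thesis by (simp add: measure_pmf.emeasure_space_1)
qed

section \<open>Comparing means that may be infinite\<close>

lemma nonneg_mean_add:
  assumes "nonneg_mean q D" "nonneg_mean q E"
  shows "nonneg_mean q (\<lambda>w. D w + E w)"
proof -
  from assms obtain g h where
    "integrable (measure_pmf q) g" "0 \<le> measure_pmf.expectation q g" "\<forall>w\<in>set_pmf q. g w \<le> D w"
    "integrable (measure_pmf q) h" "0 \<le> measure_pmf.expectation q h" "\<forall>w\<in>set_pmf q. h w \<le> E w"
    unfolding nonneg_mean_def by blast
  then show ?thesis unfolding nonneg_mean_def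
    by (intro exI[of _ "\<lambda>w. g w + h w"]) (auto intro: add_mono)
qed

lemma nonneg_mean_mono:
  assumes "nonneg_mean q D" "\<And>w. w \<in> set_pmf q \<Longrightarrow> D w \<le> E w"
  shows "nonneg_mean q E"
  using assms unfolding nonneg_mean_def by (meson order_trans)

lemma nonneg_mean_zero: "nonneg_mean q (\<lambda>_. 0)"
  unfolding nonneg_mean_def by (intro exI[of _ "\<lambda>_. 0"]) auto

text \<open>If the mean of \<open>F\<close> is infinite the bound is trivial. Otherwise
  \<open>G\<close> lies below the integrable function \<open>F - g\<close>, so \<open>G\<close> is
  integrable as well and the means can be subtracted as real numbers.\<close>

lemma nonneg_mean_imp_le:
  assumes "nonneg_mean q (\<lambda>w. F w - G w)"
    and F: "\<And>w. w \<in> set_pmf q \<Longrightarrow> 0 \<le> F w" and G: "\<And>w. w \<in> set_pmf q \<Longrightarrow> 0 \<le> G w"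
  shows "(\<integral>\<^sup>+ w. ennreal (G w) \<partial>measure_pmf q) \<le> (\<integral>\<^sup>+ w. ennreal (F w) \<partial>measure_pmf q)"
proof (cases "(\<integral>\<^sup>+ w. ennreal (F w) \<partial>measure_pmf q) = \<infinity>")
  case False
  obtain g where g: "integrable (measure_pmf q) g" "0 \<le> measure_pmf.expectation q g"
    and le: "\<forall>w\<in>set_pmf q. g w \<le> F w - G w"
    using assms(1) unfolding nonneg_mean_def by blast
  have iF: "integrable (measure_pmf q) F"
    using False F by (intro integrableI_nonneg) (auto simp: AE_measure_pmf_iff top.not_eq_extremum)
  have iG: "integrable (measure_pmf q) G"
  proof (rule Bochner_Integration.integrable_bound[of _ "\<lambda>w. F w - g w"])
    show "AE w in measure_pmf q. norm (G w) \<le> norm (F w - g w)"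
      unfolding AE_measure_pmf_iff
    proof
      fix w assume "w \<in> set_pmf q"
      with le G have "0 \<le> G w" "g w \<le> F w - G w" by auto
      then show "norm (G w) \<le> norm (F w - g w)" by simp
    qed
  qed (use iF g in auto)
  have "measure_pmf.expectation q G \<le> measure_pmf.expectation q (\<lambda>w. F w - g w)"
  proof (rule integral_mono_AE)
    show "AE w in measure_pmf q. G w \<le> F w - g w"
      unfolding AE_measure_pmf_iff
    proof
      fix w assume "w \<in> set_pmf q"
      with le have "g w \<le> F w - G w" by auto
      then show "G w \<le> F w - g w" by simp
    qed
  qed (use iF iG g in auto)
  also have "\<dots> \<le> measure_pmf.expectation q F"
    using g iF by simp
  finally show ?thesis
    using iF iG F G by (simp add: nn_integral_eq_integral AE_measure_pmf_iff ennreal_leI)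
qed simp

text \<open>Jensen's inequality for the logarithm: ln r <= r - 1 gives the integrable minorant (1 -
  r) / ln 2, whose mean is nonnegative because \<open>r\<close> has mean at most 1.\<close>

lemma nonneg_mean_neg_log:
  assumes r: "\<And>w. w \<in> set_pmf q \<Longrightarrow> 0 < r w"
    and int: "(\<integral>\<^sup>+ w. ennreal (r w) \<partial>measure_pmf q) \<le> 1"
  shows "nonneg_mean q (\<lambda>w. - log 2 (r w))"
proof -
  have r0: "AE w in measure_pmf q. 0 \<le> r w"
    using r by (auto simp: AE_measure_pmf_iff less_imp_le)
  have "(\<integral>\<^sup>+ w. ennreal (r w) \<partial>measure_pmf q) < \<infinity>"
    using int by (rule le_less_trans) simp
  then have ir: "integrable (measure_pmf q) r"
    using r0 by (intro integrableI_nonneg) simp_all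
  have "ennreal (measure_pmf.expectation q r) \<le> 1"
    using int unfolding nn_integral_eq_integral[OF ir r0] .
  then have E: "measure_pmf.expectation q r \<le> 1"
    by simp
  show ?thesis
    unfolding nonneg_mean_def
  proof (intro exI[of _ "\<lambda>w. (1 - r w) / ln 2"] conjI ballI)
    fix w assume "w \<in> set_pmf q"
    then have "ln (r w) \<le> r w - 1" using r by (intro ln_le_minus_one)
    then have "(1 - r w) / ln 2 \<le> (- ln (r w)) / ln 2"
      by (intro divide_right_mono) auto
    then show "(1 - r w) / ln 2 \<le> - log 2 (r w)"
      by (simp add: log_def)
  qed (use ir E in auto)
qed

text \<open>The integral recovers the mass that \<open>r\<close> gives to the support of
  \<open>p\<close>; mass of \<open>r\<close> outside that support is lost, hence only an
  inequality.\<close>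

lemma nn_integral_pmf_ratio_le_1:
  "(\<integral>\<^sup>+ x. ennreal (pmf r x / pmf p x) \<partial>measure_pmf p) \<le> 1"
proof -
  have "(\<integral>\<^sup>+ x. ennreal (pmf r x / pmf p x) \<partial>measure_pmf p) =
      (\<integral>\<^sup>+ x. ennreal (pmf p x) * ennreal (pmf r x / pmf p x) \<partial>count_space UNIV)"
    by (rule nn_integral_measure_pmf)
  also have "\<dots> \<le> (\<integral>\<^sup>+ x. ennreal (pmf r x) \<partial>count_space UNIV)"
  proof (rule nn_integral_mono)
    fix x show "ennreal (pmf p x) * ennreal (pmf r x / pmf p x) \<le> ennreal (pmf r x)"
      by (cases "pmf p x = 0") (simp_all add: ennreal_mult[symmetric])
  qed
  also have "\<dots> = 1"
    using measure_pmf.emeasure_space_1[of r] by (simp add: nn_integral_pmf)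
  finally show ?thesis .
qed

lemma pmf_map_eq_prob: "pmf (map_pmf f q) x = measure_pmf.prob q {v. f v = x}"
  by (simp add: pmf_map vimage_def)

lemma prob_cond_pmf:
  assumes "set_pmf q \<inter> S \<noteq> {}"
  shows "measure_pmf.prob (cond_pmf q S) T = measure_pmf.prob q (S \<inter> T) / measure_pmf.prob q S"
  by (simp add: cond_pmf.rep_eq[OF assms] emeasure_measure_pmf_not_zero[OF assms])

lemma cond_surprisal_cong2:
  assumes "w \<in> set_pmf q" "determines q B B'" "determines q B' B"
  shows "cond_surprisal q A B w = cond_surprisal q A B' w"
proof -
  have "surprisal q (\<lambda>v. (A v, B v)) w = surprisal q (\<lambda>v. (A v, B' v)) w"
    by (intro surprisal_cong determines_Pair determines_fst assms(1)
        determines_trans[OF determines_snd assms(2)] determines_trans[OF determines_snd assms(3)])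
  moreover have "surprisal q B w = surprisal q B' w" using assms by (intro surprisal_cong)
  ultimately show ?thesis by (simp add: cond_surprisal_def)
qed

lemma cond_entropy_cong2:
  assumes "determines q B B'" "determines q B' B"
  shows "cond_entropy q A B = cond_entropy q A B'"
  unfolding cond_entropy_def
  by (intro nn_integral_cong_AE) (simp add: AE_measure_pmf_iff cond_surprisal_cong2[OF _ assms])

lemma cond_entropy_cong:
  assumes "determines q (\<lambda>v. (A' v, B v)) A" "determines q (\<lambda>v. (A v, B v)) A'"
  shows "cond_entropy q A B = cond_entropy q A' B"
  by (rule antisym) (rule cond_entropy_mono[OF assms(1)], rule cond_entropy_mono[OF assms(2)])

text \<open>Gibbs' inequality in conditional form: coding \<open>A\<close> by any kernel
  \<open>K\<close> that sees only \<open>D\<close> costs on average at least H(A|D). Later bounds on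
  conditional entropies come from choosing \<open>K\<close>.\<close>

lemma gibbs:
  assumes pos: "\<And>w. w \<in> set_pmf q \<Longrightarrow> 0 < pmf (K (D w)) (A w)"
  shows "nonneg_mean q (\<lambda>w. - log 2 (pmf (K (D w)) (A w)) - cond_surprisal q A D w)"
proof -
  define T where "T = (\<lambda>w. (A w, D w))"
  \<comment> \<open>The comparison law keeps \<open>D\<close> as under \<open>q\<close> and redraws
    the first component from \<open>K (D w)\<close>; the density of this law against that of
    \<open>(A, D)\<close> has mean at most 1.\<close>
  define r where "r = bind_pmf q (\<lambda>w. map_pmf (\<lambda>a. (a, D w)) (K (D w)))"
  have pmf_r: "pmf r (T w) = pmf (K (D w)) (A w) * atom q D w" for w
  proof -
    have "pmf r (T w) = measure_pmf.expectation q (\<lambda>v. indicator {v. D v = D w} v * pmf (K (D w)) (A w))"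
      unfolding r_def pmf_bind
    proof (rule Bochner_Integration.integral_cong[OF refl])
      fix v
      have "pmf (map_pmf (\<lambda>a. (a, D v)) (K (D v))) (T w) = 0" if "D v \<noteq> D w"
        using that by (intro pmf_map_outside) (auto simp: T_def)
      moreover have "pmf (map_pmf (\<lambda>a. (a, D w)) (K (D w))) (T w) = pmf (K (D w)) (A w)"
        unfolding T_def by (rule pmf_map_inj') (auto intro: injI)
      ultimately show "pmf (map_pmf (\<lambda>a. (a, D v)) (K (D v))) (T w) =
          indicator {v. D v = D w} v * pmf (K (D w)) (A w)"
        by (cases "D v = D w") auto
    qed
    then show ?thesis by (simp add: atom_def)
  qed
  have pmf_p: "pmf (map_pmf T q) (T w) = atom q T w" for w
    by (simp add: pmf_map_eq_prob atom_def)
  have "(\<integral>\<^sup>+ w. ennreal (pmf r (T w) / pmf (map_pmf T q) (T w)) \<partial>measure_pmf q) \<le> 1"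
    using nn_integral_pmf_ratio_le_1[where p="map_pmf T q" and r=r] by (simp add: nn_integral_map_pmf)
  then have "nonneg_mean q (\<lambda>w. - log 2 (pmf r (T w) / pmf (map_pmf T q) (T w)))"
    by (intro nonneg_mean_neg_log) (auto simp: pmf_r pmf_p intro!: divide_pos_pos mult_pos_pos pos atom_pos)
  then show ?thesis
  proof (rule nonneg_mean_mono)
    fix w assume w: "w \<in> set_pmf q"
    show "- log 2 (pmf r (T w) / pmf (map_pmf T q) (T w)) \<le> - log 2 (pmf (K (D w)) (A w)) - cond_surprisal q A D w"
      using pos[OF w] atom_pos[OF w, of D] atom_pos[OF w, of T]
      by (simp add: pmf_r pmf_p log_divide log_mult cond_surprisal_def surprisal_def flip: T_def)
  qed
qed

lemma pmf_map_cond_atom: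
  assumes "w \<in> set_pmf q"
  shows "pmf (map_pmf A (cond_pmf q {v. C v = C w})) (A w) = atom q (\<lambda>v. (A v, C v)) w / atom q C w"
proof -
  have "set_pmf q \<inter> {v. C v = C w} \<noteq> {}" using assms by auto
  from prob_cond_pmf[OF this, of "{v. A v = A w}"] show ?thesis
    by (simp add: pmf_map_eq_prob atom_def Collect_conj_eq Int_commute)
qed

text \<open>I(A;B|C) >= 0: Gibbs' inequality for the kernel that receives \<open>(B, C)\<close>,
  ignores \<open>B\<close> and draws \<open>A\<close> from its conditional law given
  \<open>C\<close>.\<close>

lemma nonneg_mean_cond_mutual_information:
  fixes A :: "'w \<Rightarrow> 'a" and B :: "'w \<Rightarrow> 'b" and C :: "'w \<Rightarrow> 'c"
  shows "nonneg_mean q (\<lambda>w. cond_surprisal q A C w - cond_surprisal q A (\<lambda>v. (B v, C v)) w)"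
proof -
  define K where "K = (\<lambda>bc :: 'b \<times> 'c. map_pmf A (cond_pmf q {v. C v = snd bc}))"
  have K: "pmf (K (B w, C w)) (A w) = atom q (\<lambda>v. (A v, C v)) w / atom q C w" if "w \<in> set_pmf q" for w
    using that by (simp add: K_def pmf_map_cond_atom)
  have "nonneg_mean q (\<lambda>w. - log 2 (pmf (K (B w, C w)) (A w)) - cond_surprisal q A (\<lambda>v. (B v, C v)) w)"
    by (rule gibbs) (auto simp: K intro!: divide_pos_pos atom_pos)
  then show ?thesis
  proof (rule nonneg_mean_mono)
    fix w assume w: "w \<in> set_pmf q"
    show "- log 2 (pmf (K (B w, C w)) (A w)) - cond_surprisal q A (\<lambda>v. (B v, C v)) w
        \<le> cond_surprisal q A C w - cond_surprisal q A (\<lambda>v. (B v, C v)) w"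
      using atom_pos[OF w, of C] atom_pos[OF w, of "\<lambda>v. (A v, C v)"] w
      by (simp add: K cond_surprisal_def surprisal_def log_divide)
  qed
qed

lemma cond_entropy_cond_le: "cond_entropy q A (\<lambda>v. (B v, C v)) \<le> cond_entropy q A C"
  unfolding cond_entropy_def
  by (rule nonneg_mean_imp_le[OF nonneg_mean_cond_mutual_information]) (auto intro: cond_surprisal_nonneg)

lemma cond_entropy_cond_le_determines:
  assumes "determines q B C"
  shows "cond_entropy q A B \<le> cond_entropy q A C"
  using cond_entropy_cond_le[of q A B C] assms
    cond_entropy_cong2[OF determines_Pair[OF determines_refl assms] determines_fst, of A] by simp

lemma cond_entropy_uncond: "cond_entropy q A (\<lambda>_. ()) = (\<integral>\<^sup>+ w. ennreal (surprisal q A w) \<partial>measure_pmf q)"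
  unfolding cond_entropy_def by (intro nn_integral_cong_AE) (auto simp: AE_measure_pmf_iff cond_surprisal_const)

text \<open>The mean of \<open>interact\<close> is the interaction information \<open>I(A;B) - I(A;B|C)\<close>, symmetric in
  \<open>A, B, C\<close>.\<close>

definition interact :: "'w pmf \<Rightarrow> ('w \<Rightarrow> 'a) \<Rightarrow> ('w \<Rightarrow> 'b) \<Rightarrow> ('w \<Rightarrow> 'c) \<Rightarrow> 'w \<Rightarrow> real" where
  "interact q A B C w = surprisal q A w + surprisal q B w + surprisal q C w
     - surprisal q (\<lambda>v. (A v, B v)) w - surprisal q (\<lambda>v. (B v, C v)) w - surprisal q (\<lambda>v. (A v, C v)) w
     + surprisal q (\<lambda>v. (A v, B v, C v)) w"

lemma surprisal_swap: "w \<in> set_pmf q \<Longrightarrow> surprisal q (\<lambda>v. (A v, B v)) w = surprisal q (\<lambda>v. (B v, A v)) w"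
  by (rule surprisal_cong) (auto simp: determines_def)

lemma interact_swap12:
  assumes "w \<in> set_pmf q"
  shows "interact q A B C w = interact q B A C w"
proof -
  have "surprisal q (\<lambda>v. (A v, B v, C v)) w = surprisal q (\<lambda>v. (B v, A v, C v)) w"
    by (rule surprisal_cong) (auto simp: determines_def assms)
  then show ?thesis
    unfolding interact_def surprisal_swap[OF assms, of B A] by linarith
qed

lemma interact_swap23:
  assumes "w \<in> set_pmf q"
  shows "interact q A B C w = interact q A C B w"
proof -
  have "surprisal q (\<lambda>v. (A v, B v, C v)) w = surprisal q (\<lambda>v. (A v, C v, B v)) w"
    by (rule surprisal_cong) (auto simp: determines_def assms)
  then show ?thesis
    unfolding interact_def surprisal_swap[OF assms, of C B] by linarith
qed

lemma nonneg_mean_interact_swap12: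
  "nonneg_mean q (interact q A B C) \<Longrightarrow> nonneg_mean q (interact q B A C)"
  by (erule nonneg_mean_mono) (simp only: interact_swap12[of _ q A B])

lemma nonneg_mean_interact_swap23:
  "nonneg_mean q (interact q A B C) \<Longrightarrow> nonneg_mean q (interact q A C B)"
  by (erule nonneg_mean_mono) (simp only: interact_swap23[of _ q A B])

text \<open>When \<open>(A', C') - (A, C) - B\<close> is a Markov chain, passing to \<open>A', C'\<close> changes the interaction
  information by \<open>I(A';B|A) + I(C';B|C)\<close>.\<close>

lemma nonneg_mean_interact_step:
  assumes base: "nonneg_mean q (interact q A B C)"
    and detA: "determines q A' A" and detC: "determines q C' C"
    and markov: "\<And>w. w \<in> set_pmf q \<Longrightarrow>
      atom q (\<lambda>v. (A' v, B v, C' v)) w * atom q (\<lambda>v. (A v, C v)) w =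
      atom q (\<lambda>v. (A' v, C' v)) w * atom q (\<lambda>v. (A v, B v, C v)) w"
  shows "nonneg_mean q (interact q A' B C')"
proof -
  have "nonneg_mean q (\<lambda>w. interact q A B C w
      + (cond_surprisal q B A w - cond_surprisal q B (\<lambda>v. (A' v, A v)) w) + (cond_surprisal q B C w - cond_surprisal q B (\<lambda>v. (C' v, C v)) w))"
    by (intro nonneg_mean_add base nonneg_mean_cond_mutual_information)
  then show ?thesis
  proof (rule nonneg_mean_mono)
    fix w assume w: "w \<in> set_pmf q"
    have A: "cond_surprisal q B (\<lambda>v. (A' v, A v)) w = cond_surprisal q B A' w"
      by (rule cond_surprisal_cong2[OF w determines_fst determines_Pair[OF determines_refl detA]])
    have C: "cond_surprisal q B (\<lambda>v. (C' v, C v)) w = cond_surprisal q B C' w"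
      by (rule cond_surprisal_cong2[OF w determines_fst determines_Pair[OF determines_refl detC]])
    \<comment> \<open>The Markov identity says that the conditional probability of \<open>B\<close>
      given \<open>(A', C')\<close> is that given \<open>(A, C)\<close>; in surprisals the joint
      terms cancel and only the two single-variable increments remain.\<close>
    have "log 2 (atom q (\<lambda>v. (A' v, B v, C' v)) w * atom q (\<lambda>v. (A v, C v)) w) =
      log 2 (atom q (\<lambda>v. (A' v, C' v)) w * atom q (\<lambda>v. (A v, B v, C v)) w)"
      by (simp only: markov[OF w])
    then have "surprisal q (\<lambda>v. (A' v, B v, C' v)) w + surprisal q (\<lambda>v. (A v, C v)) w =
        surprisal q (\<lambda>v. (A' v, C' v)) w + surprisal q (\<lambda>v. (A v, B v, C v)) w"
      using atom_pos[OF w, of "\<lambda>v. (A' v, B v, C' v)"] atom_pos[OF w, of "\<lambda>v. (A v, C v)"]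
        atom_pos[OF w, of "\<lambda>v. (A' v, C' v)"] atom_pos[OF w, of "\<lambda>v. (A v, B v, C v)"]
      by (simp add: surprisal_def log_mult)
    then show "interact q A B C w + (cond_surprisal q B A w - cond_surprisal q B (\<lambda>v. (A' v, A v)) w)
        + (cond_surprisal q B C w - cond_surprisal q B (\<lambda>v. (C' v, C v)) w) \<le> interact q A' B C' w"
      unfolding A C using surprisal_swap[OF w, of B A] surprisal_swap[OF w, of B A']
      by (simp add: interact_def cond_surprisal_def)
  qed
qed

text \<open>This is I(A;B|C) <= I(A;B) with all subtracted terms moved across, so that it stays
  meaningful for infinite entropies.\<close>

lemma cond_entropy_interact:
  assumes "nonneg_mean q (interact q A B C)"
  shows "cond_entropy q A C + cond_entropy q A B \<le> cond_entropy q A (\<lambda>_. ()) + cond_entropy q A (\<lambda>v. (B v, C v))"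
proof -
  have "(\<integral>\<^sup>+ w. ennreal (cond_surprisal q A C w + cond_surprisal q A B w) \<partial>measure_pmf q)
      \<le> (\<integral>\<^sup>+ w. ennreal (cond_surprisal q A (\<lambda>_. ()) w + cond_surprisal q A (\<lambda>v. (B v, C v)) w) \<partial>measure_pmf q)"
  proof (rule nonneg_mean_imp_le)
    show "nonneg_mean q (\<lambda>w. cond_surprisal q A (\<lambda>_. ()) w + cond_surprisal q A (\<lambda>v. (B v, C v)) w - (cond_surprisal q A C w + cond_surprisal q A B w))"
      using assms by (rule nonneg_mean_mono) (simp add: cond_surprisal_const, simp add: cond_surprisal_def interact_def)
  qed (auto intro: cond_surprisal_nonneg add_nonneg_nonneg)
  then show ?thesis by (simp only: nn_integral_cond_surprisal_add)
qed

section \<open>Limits of conditional entropies\<close>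

text \<open>The threshold may depend on the sample point. In the application \<open>F t\<close> is
  the history of the first \<open>t\<close> rounds and \<open>G\<close> the final transcript, and
  run lengths need not be bounded.\<close>

definition eventually_determines :: "'w pmf \<Rightarrow> (nat \<Rightarrow> 'w \<Rightarrow> 'u) \<Rightarrow> ('w \<Rightarrow> 'v) \<Rightarrow> bool" where
  "eventually_determines q F G \<longleftrightarrow> (\<forall>w\<in>set_pmf q. \<forall>\<^sub>F t in sequentially.
     \<forall>v\<in>set_pmf q. F t v = F t w \<longrightarrow> G v = G w)"

lemma atom_eq:
  assumes "\<And>v. v \<in> set_pmf q \<Longrightarrow> A v = A w \<longleftrightarrow> B v = B w"
  shows "atom q A w = atom q B w"
  unfolding atom_def by (rule prob_cong_support) (simp add: assms)

lemma cond_surprisal_eq: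
  assumes "\<And>v. v \<in> set_pmf q \<Longrightarrow> B v = B w \<longleftrightarrow> B' v = B' w"
    and "\<And>v. v \<in> set_pmf q \<Longrightarrow> B v = B w \<Longrightarrow> A v = A w \<longleftrightarrow> A' v = A' w"
  shows "cond_surprisal q A B w = cond_surprisal q A' B' w"
proof -
  have "atom q (\<lambda>v. (A v, B v)) w = atom q (\<lambda>v. (A' v, B' v)) w"
    by (rule atom_eq) (metis assms prod.inject)
  moreover have "atom q B w = atom q B' w"
    by (rule atom_eq) (rule assms)
  ultimately show ?thesis by (simp add: cond_surprisal_def surprisal_def)
qed

text \<open>At every sample point of the support the fibre of \<open>A' t\<close> eventually
  coincides with that of \<open>A\<close>, so the integrands are eventually constant in
  \<open>t\<close> and Fatou's lemma passes the bound to the limit.\<close>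

lemma cond_entropy_add_liminf:
  assumes "eventually_determines q A' A" "\<And>t. determines q A (A' t)"
    and le: "\<forall>\<^sub>F t in sequentially. cond_entropy q (A' t) B + cond_entropy q (A' t) C \<le> c"
  shows "cond_entropy q A B + cond_entropy q A C \<le> c"
proof -
  define f where "f = (\<lambda>t w. ennreal (cond_surprisal q (A' t) B w + cond_surprisal q (A' t) C w))"
  define g where "g = (\<lambda>w. ennreal (cond_surprisal q A B w + cond_surprisal q A C w))"
  have "cond_entropy q A B + cond_entropy q A C = (\<integral>\<^sup>+ w. g w \<partial>measure_pmf q)"
    unfolding g_def by (rule nn_integral_cond_surprisal_add[symmetric])
  also have "\<dots> = (\<integral>\<^sup>+ w. liminf (\<lambda>t. f t w) \<partial>measure_pmf q)"
  proof (rule nn_integral_cong_AE, unfold AE_measure_pmf_iff, rule ballI)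
    fix w assume w: "w \<in> set_pmf q"
    have "\<forall>\<^sub>F t in sequentially. f t w = g w"
      using assms(1)[unfolded eventually_determines_def, rule_format, OF w]
    proof eventually_elim
      case (elim t)
      have "cond_surprisal q (A' t) B w = cond_surprisal q A B w"
        by (rule cond_surprisal_eq) (use elim determinesD[OF assms(2) _ w] in auto)
      moreover have "cond_surprisal q (A' t) C w = cond_surprisal q A C w"
        by (rule cond_surprisal_eq) (use elim determinesD[OF assms(2) _ w] in auto)
      ultimately show ?case by (simp add: f_def g_def)
    qed
    then have "(\<lambda>t. f t w) \<longlonglongrightarrow> g w"
      by (rule tendsto_eventually)
    then show "g w = liminf (\<lambda>t. f t w)"
      by (intro lim_imp_Liminf[symmetric]) auto
  qed
  also have "\<dots> \<le> liminf (\<lambda>t. \<integral>\<^sup>+ w. f t w \<partial>measure_pmf q)"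
    by (intro nn_integral_liminf) auto
  also have "\<dots> \<le> liminf (\<lambda>t::nat. c)"
    unfolding f_def nn_integral_cond_surprisal_add by (rule Liminf_mono) (rule le)
  also have "\<dots> = c"
    by (simp add: Liminf_const)
  finally show ?thesis .
qed

text \<open>Where \<open>D\<close> pins down \<open>B\<close> the surprisal of \<open>A\<close> given \<open>D\<close> is that given \<open>B\<close>;
  elsewhere \<open>A\<close> is coded with its marginal law, which Gibbs' inequality permits.\<close>

lemma cond_entropy_le_mixed:
  fixes A :: "'w \<Rightarrow> 'a" and B :: "'w \<Rightarrow> 'b" and D :: "'w \<Rightarrow> 'd"
  assumes "determines q B D"
  shows "cond_entropy q A D \<le> (\<integral>\<^sup>+ w. ennreal (if \<forall>v\<in>set_pmf q. D v = D w \<longrightarrow> B v = B w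
      then cond_surprisal q A B w else surprisal q A w) \<partial>measure_pmf q)"
proof -
  define T where "T = (\<lambda>d. \<forall>v\<in>set_pmf q. \<forall>v'\<in>set_pmf q. D v = d \<longrightarrow> D v' = d \<longrightarrow> B v = B v')"
  have T: "T (D w) \<longleftrightarrow> (\<forall>v\<in>set_pmf q. D v = D w \<longrightarrow> B v = B w)" if "w \<in> set_pmf q" for w
    unfolding T_def using that by metis
  define K where "K = (\<lambda>d. if T d then map_pmf A (cond_pmf q {v. D v = d}) else map_pmf A q)"
  have K: "pmf (K (D w)) (A w) = (if T (D w) then atom q (\<lambda>v. (A v, D v)) w / atom q D w else atom q A w)"
    if "w \<in> set_pmf q" for w
    using that by (simp add: K_def pmf_map_cond_atom) (simp add: pmf_map_eq_prob atom_def)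
  have "nonneg_mean q (\<lambda>w. - log 2 (pmf (K (D w)) (A w)) - cond_surprisal q A D w)"
    by (rule gibbs) (auto simp: K intro!: divide_pos_pos atom_pos)
  then have "cond_entropy q A D \<le> (\<integral>\<^sup>+ w. ennreal (- log 2 (pmf (K (D w)) (A w))) \<partial>measure_pmf q)"
    unfolding cond_entropy_def
  proof (rule nonneg_mean_imp_le)
    fix w assume w: "w \<in> set_pmf q"
    have "0 < pmf (K (D w)) (A w)" using w by (auto simp: K intro!: divide_pos_pos atom_pos)
    then show "0 \<le> - log 2 (pmf (K (D w)) (A w))" by (simp add: pmf_le_1)
  qed (rule cond_surprisal_nonneg)
  also have "\<dots> = (\<integral>\<^sup>+ w. ennreal (if \<forall>v\<in>set_pmf q. D v = D w \<longrightarrow> B v = B w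
      then cond_surprisal q A B w else surprisal q A w) \<partial>measure_pmf q)"
  proof (rule nn_integral_cong_AE, unfold AE_measure_pmf_iff, rule ballI)
    fix w assume w: "w \<in> set_pmf q"
    have "- log 2 (pmf (K (D w)) (A w)) = cond_surprisal q A B w" if t: "T (D w)"
    proof -
      have "cond_surprisal q A D w = cond_surprisal q A B w"
        by (rule cond_surprisal_eq) (use t[unfolded T[OF w]] determinesD[OF assms _ w] in auto)
      then show ?thesis
        using t w atom_pos[OF w, of D] atom_pos[OF w, of "\<lambda>v. (A v, D v)"]
        by (simp add: K log_divide cond_surprisal_def surprisal_def)
    qed
    moreover have "- log 2 (pmf (K (D w)) (A w)) = surprisal q A w" if "\<not> T (D w)"
      using that by (simp add: K[OF w] surprisal_def)
    ultimately show "ennreal (- log 2 (pmf (K (D w)) (A w))) =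
        ennreal (if \<forall>v\<in>set_pmf q. D v = D w \<longrightarrow> B v = B w then cond_surprisal q A B w else surprisal q A w)"
      unfolding T[OF w, symmetric] by simp
  qed
  finally show ?thesis .
qed

text \<open>H(A|D t) exceeds H(A|B) by at most the mean surprisal of \<open>A\<close> on the event
  \<open>N t\<close> that \<open>D t\<close> does not yet pin down \<open>B\<close>. This error
  tends to 0 by dominated convergence, with the integrable surprisal of \<open>A\<close> as
  dominating function.\<close>

lemma cond_entropy_limsup:
  assumes fin: "cond_entropy q A (\<lambda>_. ()) \<noteq> \<infinity>"
    and ev: "eventually_determines q D B" and det: "\<And>t. determines q B (D t)"
    and le: "\<And>t. c \<le> cond_entropy q A (D t) + h"
  shows "c \<le> cond_entropy q A B + h"
proof -
  define N where "N = (\<lambda>t w. \<not> (\<forall>v\<in>set_pmf q. D t v = D t w \<longrightarrow> B v = B w))"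
  have bound: "cond_entropy q A (D t) \<le> cond_entropy q A B + (\<integral>\<^sup>+ w. ennreal (of_bool (N t w) * surprisal q A w) \<partial>measure_pmf q)" for t
  proof -
    have "cond_entropy q A (D t) \<le> (\<integral>\<^sup>+ w. ennreal (if \<not> N t w then cond_surprisal q A B w else surprisal q A w) \<partial>measure_pmf q)"
      using cond_entropy_le_mixed[OF det, of A t] by (simp add: N_def)
    also have "\<dots> \<le> (\<integral>\<^sup>+ w. ennreal (cond_surprisal q A B w) + ennreal (of_bool (N t w) * surprisal q A w) \<partial>measure_pmf q)"
      by (intro nn_integral_mono_AE) (auto simp: AE_measure_pmf_iff cond_surprisal_nonneg surprisal_nonneg)
    finally show ?thesis by (simp add: nn_integral_add cond_entropy_def)
  qed
  have int: "integrable (measure_pmf q) (surprisal q A)"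
    using fin unfolding cond_entropy_uncond
    by (intro integrableI_nonneg) (auto simp: AE_measure_pmf_iff surprisal_nonneg top.not_eq_extremum)
  have "(\<lambda>t. measure_pmf.expectation q (\<lambda>w. of_bool (N t w) * surprisal q A w))
      \<longlonglongrightarrow> measure_pmf.expectation q (\<lambda>w. 0)"
  proof (rule integral_dominated_convergence[OF _ _ int])
    show "AE w in measure_pmf q. (\<lambda>t. of_bool (N t w) * surprisal q A w) \<longlonglongrightarrow> 0"
      unfolding AE_measure_pmf_iff
    proof
      fix w assume w: "w \<in> set_pmf q"
      have "\<forall>\<^sub>F t in sequentially. of_bool (N t w) * surprisal q A w = 0"
        using ev[unfolded eventually_determines_def, rule_format, OF w]
        by eventually_elim (simp add: N_def)
      then show "(\<lambda>t. of_bool (N t w) * surprisal q A w) \<longlonglongrightarrow> 0"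
        by (rule tendsto_eventually)
    qed
    show "AE w in measure_pmf q. norm (of_bool (N t w) * surprisal q A w) \<le> surprisal q A w" for t
      by (auto simp: AE_measure_pmf_iff surprisal_nonneg)
  qed auto
  then have lim: "(\<lambda>t. ennreal (measure_pmf.expectation q (\<lambda>w. of_bool (N t w) * surprisal q A w))) \<longlonglongrightarrow> 0"
    by (simp add: tendsto_ennrealI flip: ennreal_0)
  have nn: "(\<integral>\<^sup>+ w. ennreal (of_bool (N t w) * surprisal q A w) \<partial>measure_pmf q) =
      ennreal (measure_pmf.expectation q (\<lambda>w. of_bool (N t w) * surprisal q A w))" for t
  proof (rule nn_integral_eq_integral)
    show "integrable (measure_pmf q) (\<lambda>w. of_bool (N t w) * surprisal q A w)"
      by (rule Bochner_Integration.integrable_bound[OF int]) (auto simp: AE_measure_pmf_iff)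
  qed (auto simp: AE_measure_pmf_iff surprisal_nonneg)
  have "(\<lambda>t. cond_entropy q A B + ennreal (measure_pmf.expectation q (\<lambda>w. of_bool (N t w) * surprisal q A w)) + h)
      \<longlonglongrightarrow> cond_entropy q A B + 0 + h"
    by (intro tendsto_add tendsto_const lim)
  moreover have "\<forall>t. c \<le> cond_entropy q A B + ennreal (measure_pmf.expectation q (\<lambda>w. of_bool (N t w) * surprisal q A w)) + h"
    using le bound unfolding nn by (meson add_right_mono order_trans)
  ultimately show ?thesis
    using LIMSEQ_le_const by fastforce
qed

text \<open>Carries the interaction inequality from truncated variables to their limits. Fatou's
  lemma first replaces \<open>A' s\<close> by \<open>A\<close> for a fixed conditioning index
  \<open>t\<close>; only then does \<open>t\<close> grow, which is where the finiteness of H(A)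
  enters.\<close>

lemma cond_entropy_interact_limit:
  assumes int: "\<And>t. nonneg_mean q (interact q (A' t) (B' t) (C' t))"
    and detA: "\<And>t. determines q A (A' t)" and detB: "\<And>t. determines q B (B' t)"
    and detC: "\<And>t. determines q C (C' t)"
    and evA: "eventually_determines q A' A" and evB: "eventually_determines q B' B"
    and evC: "eventually_determines q C' C"
    and refB: "\<And>s t. t \<le> s \<Longrightarrow> determines q (B' s) (B' t)"
    and refC: "\<And>s t. t \<le> s \<Longrightarrow> determines q (C' s) (C' t)"
    and fin: "cond_entropy q A (\<lambda>_. ()) \<noteq> \<infinity>"
  shows "cond_entropy q A C + cond_entropy q A B \<le> cond_entropy q A (\<lambda>v. (B v, C v)) + cond_entropy q A (\<lambda>_. ())"
proof (rule cond_entropy_limsup[OF fin, where D = "\<lambda>t v. (B' t v, C' t v)"])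
  show "eventually_determines q (\<lambda>t v. (B' t v, C' t v)) (\<lambda>v. (B v, C v))"
    unfolding eventually_determines_def
  proof
    fix w assume w: "w \<in> set_pmf q"
    from evB[unfolded eventually_determines_def, rule_format, OF w]
      evC[unfolded eventually_determines_def, rule_format, OF w]
    show "\<forall>\<^sub>F t in sequentially. \<forall>v\<in>set_pmf q. (B' t v, C' t v) = (B' t w, C' t w) \<longrightarrow> (B v, C v) = (B w, C w)"
      by eventually_elim auto
  qed
  show "determines q (\<lambda>v. (B v, C v)) (\<lambda>v. (B' t v, C' t v))" for t
    by (intro determines_Pair determines_trans[OF determines_fst detB] determines_trans[OF determines_snd detC])
  fix t
  \<comment> \<open>Two indices are kept apart: the inequality is used at the fine level
    \<open>s\<close>, and the conditioning on the right is then coarsened to \<open>t\<close>, so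
    that the bound no longer depends on \<open>s\<close>.\<close>
  have "cond_entropy q (A' s) C + cond_entropy q (A' s) B \<le> cond_entropy q A (\<lambda>v. (B' t v, C' t v)) + cond_entropy q A (\<lambda>_. ())" if s: "t \<le> s" for s
  proof -
    have "cond_entropy q (A' s) C + cond_entropy q (A' s) B \<le> cond_entropy q (A' s) (C' s) + cond_entropy q (A' s) (B' s)"
      by (intro add_mono cond_entropy_cond_le_determines detB detC)
    also have "\<dots> \<le> cond_entropy q (A' s) (\<lambda>_. ()) + cond_entropy q (A' s) (\<lambda>v. (B' s v, C' s v))"
      by (rule cond_entropy_interact) (rule int)
    also have "\<dots> \<le> cond_entropy q A (\<lambda>_. ()) + cond_entropy q A (\<lambda>v. (B' s v, C' s v))"
      by (intro add_mono cond_entropy_mono determines_trans[OF determines_fst detA])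
    also have "cond_entropy q A (\<lambda>v. (B' s v, C' s v)) \<le> cond_entropy q A (\<lambda>v. (B' t v, C' t v))"
      by (intro cond_entropy_cond_le_determines determines_Pair determines_trans[OF determines_fst refB[OF s]]
          determines_trans[OF determines_snd refC[OF s]])
    finally show ?thesis by (simp add: add.commute add_left_mono)
  qed
  then show "cond_entropy q A C + cond_entropy q A B \<le> cond_entropy q A (\<lambda>v. (B' t v, C' t v)) + cond_entropy q A (\<lambda>_. ())"
    by (intro cond_entropy_add_liminf[OF evA detA]) (auto simp: eventually_sequentially)
qed

text \<open>Here \<open>A, B, C\<close> play the roles of \<open>M\<^sub>1\<^sub>2, M\<^sub>2\<^sub>3, M\<^sub>3\<^sub>1\<close>.\<close>

lemma entropy_bound_from_interact:
  fixes n :: nat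
  assumes int: "cond_entropy q A C + cond_entropy q A B \<le> cond_entropy q A (\<lambda>v. (B v, C v)) + cond_entropy q A (\<lambda>_. ())"
    and X: "determines q (\<lambda>v. (A v, C v)) X" and Y: "determines q (\<lambda>v. (A v, B v)) Y"
    and Z: "determines q (\<lambda>v. (B v, C v)) Z"
    and XC: "cond_entropy q X C = ennreal n" and YB: "cond_entropy q Y B = ennreal n"
    and XZ: "cond_entropy q X Z \<le> ennreal (n / 2)"
    and fin: "cond_entropy q A (\<lambda>_. ()) \<noteq> \<infinity>"
  shows "ennreal (3 / 2 * n) \<le> cond_entropy q A (\<lambda>_. ())"
proof -
  define a where "a = cond_entropy q A (\<lambda>v. (X v, C v))"
  \<comment> \<open>As \<open>A\<close> and \<open>C\<close> determine \<open>X\<close>, adjoining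
    \<open>X\<close> to \<open>A\<close> costs nothing given \<open>C\<close>; the chain rule then
    splits off H(X|C) = n.\<close>
  have "cond_entropy q A C = cond_entropy q (\<lambda>v. (X v, A v)) C"
    by (rule cond_entropy_cong, rule determines_trans[OF determines_fst determines_snd])
       (intro determines_Pair X determines_fst)
  then have AC: "cond_entropy q A C = ennreal (real n) + a"
    by (simp add: cond_entropy_chain XC a_def)
  have AB: "ennreal n \<le> cond_entropy q A B"
    unfolding YB[symmetric] by (rule cond_entropy_mono) (rule Y)
  have X': "determines q (\<lambda>v. (A v, B v, C v)) X"
    by (rule determines_trans[OF _ X]) (auto simp: determines_def)
  have "cond_entropy q A (\<lambda>v. (B v, C v)) = cond_entropy q (\<lambda>v. (X v, A v)) (\<lambda>v. (B v, C v))"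
    by (rule cond_entropy_cong, rule determines_trans[OF determines_fst determines_snd])
       (intro determines_Pair X' determines_fst)
  also have "\<dots> = cond_entropy q X (\<lambda>v. (B v, C v)) + cond_entropy q A (\<lambda>v. (X v, B v, C v))"
    by (rule cond_entropy_chain)
  \<comment> \<open>\<open>Z\<close> is a function of \<open>(B, C)\<close>, so H(X|B,C) <= H(X|Z);
    in the second summand the conditioning on \<open>B\<close> is dropped.\<close>
  also have "\<dots> \<le> ennreal (n / 2) + a"
    unfolding a_def
    by (intro add_mono order_trans[OF cond_entropy_cond_le_determines[OF Z] XZ] cond_entropy_cond_le_determines)
       (auto simp: determines_def)
  finally have ABC: "cond_entropy q A (\<lambda>v. (B v, C v)) \<le> ennreal (n / 2) + a" .
  have "a \<le> cond_entropy q A (\<lambda>_. ())"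
    unfolding a_def by (rule cond_entropy_cond_le_determines) (auto simp: determines_def)
  \<comment> \<open>The term \<open>a\<close> occurs on both sides. It is at most H(A), hence
    finite, and can be cancelled in the reals.\<close>
  then obtain a' h where ah: "a = ennreal a'" "0 \<le> a'" "cond_entropy q A (\<lambda>_. ()) = ennreal h" "0 \<le> h"
    using fin by (cases a; cases "cond_entropy q A (\<lambda>_. ())") (auto simp: top_unique)
  have "ennreal n + a + ennreal n \<le> ennreal (n / 2) + a + cond_entropy q A (\<lambda>_. ())"
    using order_trans[OF add_mono[OF eq_refl[OF AC[symmetric]] AB] order_trans[OF int add_right_mono[OF ABC]]] by simp
  then have "ennreal (n + a' + n) \<le> ennreal (n / 2 + a' + h)"
    using ah by (simp flip: ennreal_plus)
  then have "n + a' + n \<le> n / 2 + a' + h"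
    using ah by (subst (asm) ennreal_le_iff) auto
  then show ?thesis using ah by simp
qed

section \<open>Recovering rounds from a transcript\<close>

definition consistent :: "(hist \<Rightarrow> bool list set) \<Rightarrow> (hist \<Rightarrow> bool list set) \<Rightarrow> hist \<Rightarrow> bool" where
  "consistent c1 c2 h \<longleftrightarrow> (\<forall>i<length h. fst (h ! i) \<in> c1 (take i h) \<and> snd (h ! i) \<in> c2 (take i h))"

lemma consistent_Nil [simp]: "consistent c1 c2 []"
  by (simp add: consistent_def)

lemma consistent_snoc [simp]:
  "consistent c1 c2 (h @ [uv]) \<longleftrightarrow> consistent c1 c2 h \<and> fst uv \<in> c1 h \<and> snd uv \<in> c2 h"
  by (auto simp: consistent_def less_Suc_eq nth_append)

lemma consistent_take: "consistent c1 c2 h \<Longrightarrow> consistent c1 c2 (take t h)"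
  by (simp add: consistent_def min_def)

lemma flat_append [simp]: "flat (h @ g) = flat h @ flat g"
  by (simp add: flat_def)

lemma flat_snoc: "flat (h @ [(u, v)]) = flat h @ u @ v"
  by (simp add: flat_def)

lemma flat_replicate [simp]: "flat (replicate k ([], [])) = []"
  by (induction k) (simp_all add: flat_def)

lemma flat_take_prefix: "prefix (flat (take t h)) (flat h)"
  by (metis append_take_drop_id flat_append prefixI)

text \<open>Unique decodability: by induction the earlier rounds agree, so the same codes are in
  force in the last round, and two codewords of a prefix-free code that begin the same word are
  equal.\<close>

lemma consistent_unique:
  assumes pf: "\<And>h. prefix_free (c1 h)" "\<And>h. prefix_free (c2 h)"
  shows "consistent c1 c2 h \<Longrightarrow> consistent c1 c2 h' \<Longrightarrow> length h = length h' \<Longrightarrow>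
    prefix (flat h) m \<Longrightarrow> prefix (flat h') m \<Longrightarrow> h = h'"
proof (induction h arbitrary: h' rule: rev_induct)
  case (snoc uv h)
  obtain uv' g where h': "h' = g @ [uv']"
    using snoc.prems(3) by (cases h' rule: rev_cases) auto
  obtain u v u' v' where uv: "uv = (u, v)" "uv' = (u', v')" by (cases uv, cases uv')
  from snoc.prems have pre: "prefix (flat h @ u @ v) m" "prefix (flat g @ u' @ v') m"
    by (simp_all add: h' uv flat_snoc del: flat_append)
  then have "prefix (flat h) m" "prefix (flat g) m" by (auto dest: append_prefixD)
  with snoc h' have hg: "h = g" by auto
  obtain s where s: "m = flat h @ u @ v @ s"
    using pre(1) by (auto simp: prefix_def)
  moreover obtain s' where s': "m = flat h @ u' @ v' @ s'"
    using pre(2) by (auto simp: prefix_def hg)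
  ultimately have eq: "u @ v @ s = u' @ v' @ s'" by simp
  then have "prefix u u' \<or> prefix u' u" by (auto simp: append_eq_append_conv2)
  moreover have "u \<in> c1 h" "u' \<in> c1 h" "v \<in> c2 h" "v' \<in> c2 h"
    using snoc.prems by (auto simp: h' hg uv)
  ultimately have u: "u = u'" using pf(1)[of h] unfolding prefix_free_def by metis
  with eq have "v @ s = v' @ s'" by simp
  then have "prefix v v' \<or> prefix v' v" by (auto simp: append_eq_append_conv2)
  then have "v = v'" using pf(2)[of h] \<open>v \<in> c2 h\<close> \<open>v' \<in> c2 h\<close> unfolding prefix_free_def by metis
  then show ?case by (simp add: h' hg uv u)
qed simp

text \<open>Decodes the first \<open>t\<close> rounds from the bit string of a link. The description
  is meaningful when such a beginning exists, which silent padding ensures for finished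
  transcripts.\<close>

definition parse :: "(hist \<Rightarrow> bool list set) \<Rightarrow> (hist \<Rightarrow> bool list set) \<Rightarrow> nat \<Rightarrow> bool list \<Rightarrow> hist" where
  "parse c1 c2 t m = (THE h. length h = t \<and> consistent c1 c2 h \<and> prefix (flat h) m)"

definition finished :: "(hist \<Rightarrow> bool list set) \<Rightarrow> (hist \<Rightarrow> bool list set) \<Rightarrow> bool list \<Rightarrow> bool" where
  "finished c1 c2 m \<longleftrightarrow> (\<exists>h. consistent c1 c2 h \<and> quiet c1 c2 h \<and> flat h = m)"

lemma quiet_extend: "quiet c1 c2 h \<Longrightarrow> quiet c1 c2 (h @ replicate k ([], []))"
  unfolding quiet_def append_assoc replicate_add[symmetric] by blast

text \<open>Once a link is quiet, every further code is the singleton of the empty word, so round by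
  round only the empty pair can follow.\<close>

lemma quiet_consistent_append:
  assumes "quiet c1 c2 h"
  shows "consistent c1 c2 (h @ g) \<longleftrightarrow> consistent c1 c2 h \<and> g = replicate (length g) ([], [])"
proof (induction g rule: rev_induct)
  case (snoc uv g)
  have q: "c1 (h @ replicate (length g) ([], [])) = {[]}" "c2 (h @ replicate (length g) ([], [])) = {[]}"
    using assms by (auto simp: quiet_def)
  have "consistent c1 c2 (h @ g @ [uv]) \<longleftrightarrow>
      consistent c1 c2 (h @ g) \<and> fst uv \<in> c1 (h @ g) \<and> snd uv \<in> c2 (h @ g)"
    using consistent_snoc[of c1 c2 "h @ g" uv] by simp
  also have "\<dots> \<longleftrightarrow> consistent c1 c2 h \<and> g = replicate (length g) ([], []) \<and> uv = ([], [])"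
  proof (cases "g = replicate (length g) ([], [])")
    case True
    then have "c1 (h @ g) = {[]}" "c2 (h @ g) = {[]}" using q by simp_all
    then show ?thesis using snoc by (cases uv) simp
  next
    case False
    then show ?thesis using snoc by blast
  qed
  also have "\<dots> \<longleftrightarrow> consistent c1 c2 h \<and> g @ [uv] = replicate (length (g @ [uv])) ([], [])"
  proof -
    have *: "replicate (length (g @ [uv])) ([], []) = replicate (length g) ([], []) @ [([], [])]"
      by (simp add: replicate_append_same)
    show ?thesis unfolding * append1_eq_conv by blast
  qed
  finally show ?case .
qed simp

context
  fixes c1 c2 :: "hist \<Rightarrow> bool list set"
  assumes pf: "\<And>h. prefix_free (c1 h)" "\<And>h. prefix_free (c2 h)"
begin

lemma parse_eqI:
  assumes "length h = t" "consistent c1 c2 h" "prefix (flat h) m"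
  shows "parse c1 c2 t m = h"
  unfolding parse_def
  by (rule the_equality) (use assms consistent_unique[OF pf] in auto)

lemma parse_take:
  assumes "consistent c1 c2 h" "t \<le> length h"
  shows "parse c1 c2 t (flat h) = take t h"
  using assms by (intro parse_eqI consistent_take flat_take_prefix) auto

text \<open>Silent rounds can be appended without changing the bit string, so a finished transcript
  has witnessing histories of any minimal length.\<close>

lemma finished_long:
  assumes "finished c1 c2 m"
  obtains h where "consistent c1 c2 h" "quiet c1 c2 h" "flat h = m" "t \<le> length h"
proof -
  obtain h where h: "consistent c1 c2 h" "quiet c1 c2 h" "flat h = m"
    using assms by (auto simp: finished_def)
  show ?thesis
    by (rule that[of "h @ replicate t ([], [])"])
       (use h quiet_consistent_append[OF h(2)] in \<open>auto intro: quiet_extend\<close>)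
qed

lemma parse_parse:
  assumes "finished c1 c2 m" "t \<le> s"
  shows "parse c1 c2 t m = take t (parse c1 c2 s m)"
proof -
  obtain h where h: "consistent c1 c2 h" "quiet c1 c2 h" "flat h = m" "s \<le> length h"
    using finished_long[OF assms(1)] .
  then show ?thesis using parse_take[OF h(1), of t] parse_take[OF h(1), of s] assms(2)
    by (simp add: min_absorb1)
qed

text \<open>The threshold is the length of a quiet history of \<open>m\<close>: another finished
  transcript that agrees with it on these rounds can continue only with silent ones, so its bit
  string is the same.\<close>

lemma parse_eventually_injective:
  assumes "finished c1 c2 m"
  shows "\<forall>\<^sub>F t in sequentially. \<forall>m'. finished c1 c2 m' \<longrightarrow> parse c1 c2 t m' = parse c1 c2 t m \<longrightarrow> m' = m"
proof -
  obtain h where h: "consistent c1 c2 h" "quiet c1 c2 h" "flat h = m"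
    using assms by (auto simp: finished_def)
  have "m' = m" if m': "finished c1 c2 m'" "parse c1 c2 (length h) m' = parse c1 c2 (length h) m" for m'
  proof -
    obtain h' where h': "consistent c1 c2 h'" "quiet c1 c2 h'" "flat h' = m'" "length h \<le> length h'"
      using finished_long[OF m'(1)] .
    have "take (length h) h' = h"
      using parse_take[OF h'(1,4)] parse_take[OF h(1) order_refl] m'(2) h(3) h'(3) by simp
    then obtain g where g: "h' = h @ g" by (metis append_take_drop_id)
    with h'(1) quiet_consistent_append[OF h(2)] have "g = replicate (length g) ([], [])" by blast
    then have "flat g = []" by (metis flat_replicate)
    then show ?thesis using g h(3) h'(3) by simp
  qed
  then show ?thesis
    unfolding eventually_sequentially
    by (intro exI[of _ "length h"]) (metis assms parse_parse)
qed

end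

section \<open>The law of the final transcripts\<close>

text \<open>The law of \<open>f\<close> restricted to the event \<open>E\<close> has mass below 1 in
  general; sending the complement of \<open>E\<close> to \<open>None\<close> completes it to a
  probability law.\<close>

lemma nn_integral_prob_fibre:
  "(\<integral>\<^sup>+ m. ennreal (measure_pmf.prob q {s. E s \<and> f s = m}) \<partial>count_space M) =
    ennreal (measure_pmf.prob q {s. E s \<and> f s \<in> M})"
proof -
  define r where "r = map_pmf (\<lambda>s. if E s then Some (f s) else None) q"
  have "pmf r (Some m) = measure_pmf.prob q {s. E s \<and> f s = m}" for m
    unfolding r_def pmf_map_eq_prob by (rule arg_cong[where f = "measure_pmf.prob q"]) auto
  moreover have "emeasure (measure_pmf r) (Some ` M) = ennreal (measure_pmf.prob q {s. E s \<and> f s \<in> M})"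
    unfolding measure_pmf.emeasure_eq_measure r_def measure_map_pmf
    by (intro arg_cong[where f = ennreal] arg_cong[where f = "measure_pmf.prob q"]) (auto split: if_splits)
  ultimately show ?thesis
    using nn_integral_pmf'[of Some M r] by simp
qed

text \<open>Both mass functions have total 1, so pointwise domination leaves no room for a strict
  inequality anywhere.\<close>

lemma pmf_eq_of_le:
  assumes "\<And>x. pmf p x \<le> pmf q x"
  shows "p = q"
proof (rule ccontr)
  assume "p \<noteq> q"
  then obtain x where "pmf q x < pmf p x" using pmf_neq_exists_less[of q p] by metis
  with assms[of x] show False by simp
qed

lemma embed_pmf_pmf: "embed_pmf (pmf p) = p"
  using type_definition.Rep_inverse[OF td_pmf_embed_pmf] .

lemma pmf_bind_map_Pair: "pmf (bind_pmf p (\<lambda>x. map_pmf (Pair x) (K x))) (a, b) = pmf p a * pmf (K a) b"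
proof -
  have "pmf (bind_pmf p (\<lambda>x. map_pmf (Pair x) (K x))) (a, b) =
      measure_pmf.expectation p (\<lambda>x. indicator {a} x * pmf (K a) b)"
    unfolding pmf_bind
  proof (rule Bochner_Integration.integral_cong[OF refl])
    fix x
    have "pmf (map_pmf (Pair x) (K x)) (a, b) = 0" if "x \<noteq> a"
      using that by (intro pmf_map_outside) auto
    moreover have "pmf (map_pmf (Pair a) (K a)) (a, b) = pmf (K a) b"
      by (rule pmf_map_inj') (auto intro: injI)
    ultimately show "pmf (map_pmf (Pair x) (K x)) (a, b) = indicator {a} x * pmf (K a) b"
      by (cases "x = a") auto
  qed
  then show ?thesis by (simp add: measure_pmf_single)
qed

type_synonym msgs = "(bool list \<times> bool list)"

text \<open>Given the histories the three parties draw independently. Messages are grouped by sender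
  here; \<open>glue\<close> regroups them by link.\<close>

definition round_pmf :: "('a, 'b, 'c) protocol \<Rightarrow> 'a \<Rightarrow> 'b \<Rightarrow> hist \<times> hist \<times> hist \<Rightarrow> (msgs \<times> msgs \<times> msgs) pmf" where
  "round_pmf P x y = (\<lambda>(h12, h23, h31).
     pair_pmf (kA P x h12 h31) (pair_pmf (kB P y h12 h23) (kC P h23 h31)))"

definition glue :: "(hist \<times> hist \<times> hist) \<times> msgs \<times> msgs \<times> msgs \<Rightarrow> hist \<times> hist \<times> hist" where
  "glue = (\<lambda>((h12, h23, h31), (a2b, a2c), (b2a, b2c), (c2b, c2a)).
     (h12 @ [(a2b, b2a)], h23 @ [(b2c, c2b)], h31 @ [(c2a, a2c)]))"

text \<open>The old histories are kept beside the new messages, so that a round can later be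
  revealed one party at a time.\<close>

definition extend_pmf :: "('a, 'b, 'c) protocol \<Rightarrow> 'a \<Rightarrow> 'b \<Rightarrow> nat \<Rightarrow> ((hist \<times> hist \<times> hist) \<times> msgs \<times> msgs \<times> msgs) pmf" where
  "extend_pmf P x y t = bind_pmf (state P x y t) (\<lambda>h. map_pmf (Pair h) (round_pmf P x y h))"

lemma state_Suc_glue: "state P x y (Suc t) = map_pmf glue (extend_pmf P x y t)"
  unfolding extend_pmf_def round_pmf_def
  by (simp add: map_bind_pmf map_pmf_comp pair_pmf_def split_def map_pmf_def bind_assoc_pmf bind_return_pmf glue_def)

lemma map_fst_extend_pmf: "map_pmf fst (extend_pmf P x y t) = state P x y t"
  unfolding extend_pmf_def by (simp add: map_bind_pmf map_pmf_comp map_pmf_const bind_return_pmf')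

lemma inj_glue: "inj glue"
  by (auto intro!: injI simp: glue_def split: prod.splits)

section \<open>Runs of a valid protocol: truncation, decoding and termination\<close>

locale valid_prot =
  fixes P :: "('a, 'b, 'c) protocol"
  assumes valid: "valid_protocol P"
begin

lemma prefix_free_codes:
  "prefix_free (cA2B P h)" "prefix_free (cB2A P h)" "prefix_free (cB2C P h)"
  "prefix_free (cC2B P h)" "prefix_free (cC2A P h)" "prefix_free (cA2C P h)"
  using valid unfolding valid_protocol_def by auto

definition proper :: "nat \<Rightarrow> hist \<times> hist \<times> hist \<Rightarrow> bool" where
  "proper t = (\<lambda>(h12, h23, h31).
     length h12 = t \<and> length h23 = t \<and> length h31 = t \<and>
     consistent (cA2B P) (cB2A P) h12 \<and> consistent (cB2C P) (cC2B P) h23 \<and> consistent (cC2A P) (cA2C P) h31)"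

lemma round_pmf_support:
  assumes "(u, v, w) \<in> set_pmf (round_pmf P x y (h12, h23, h31))"
  shows "fst u \<in> cA2B P h12" "snd u \<in> cA2C P h31" "fst v \<in> cB2A P h12" "snd v \<in> cB2C P h23"
    "fst w \<in> cC2B P h23" "snd w \<in> cC2A P h31"
proof -
  have "u \<in> set_pmf (kA P x h12 h31)" "v \<in> set_pmf (kB P y h12 h23)" "w \<in> set_pmf (kC P h23 h31)"
    using assms by (auto simp: round_pmf_def)
  moreover have "set_pmf (kA P x h12 h31) \<subseteq> cA2B P h12 \<times> cA2C P h31"
    "set_pmf (kB P y h12 h23) \<subseteq> cB2A P h12 \<times> cB2C P h23"
    "set_pmf (kC P h23 h31) \<subseteq> cC2B P h23 \<times> cC2A P h31"
    using valid unfolding valid_protocol_def by auto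
  ultimately have "u \<in> cA2B P h12 \<times> cA2C P h31" "v \<in> cB2A P h12 \<times> cB2C P h23" "w \<in> cC2B P h23 \<times> cC2A P h31"
    by auto
  then show "fst u \<in> cA2B P h12" "snd u \<in> cA2C P h31" "fst v \<in> cB2A P h12" "snd v \<in> cB2C P h23"
    "fst w \<in> cC2B P h23" "snd w \<in> cC2A P h31"
    by auto
qed

lemma state_proper: "s \<in> set_pmf (state P x y t) \<Longrightarrow> proper t s"
proof (induction t arbitrary: s)
  case 0
  then show ?case by (auto simp: proper_def)
next
  case (Suc t)
  then obtain h u v w where hs: "h \<in> set_pmf (state P x y t)" "(u, v, w) \<in> set_pmf (round_pmf P x y h)"
    "s = glue (h, u, v, w)"
    unfolding state_Suc_glue extend_pmf_def by (auto simp del: state.simps)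
  obtain h12 h23 h31 where h: "h = (h12, h23, h31)" by (cases h)
  have "proper t (h12, h23, h31)" using Suc.IH[OF hs(1)] h by simp
  with round_pmf_support[OF hs(2)[unfolded h]] show ?case
    by (simp add: hs(3) h glue_def proper_def split_def)
qed

definition cut :: "nat \<Rightarrow> hist \<times> hist \<times> hist \<Rightarrow> hist \<times> hist \<times> hist" where
  "cut t = (\<lambda>(h12, h23, h31). (take t h12, take t h23, take t h31))"

text \<open>Removing the last round undoes one step of the process, since the histories before it
  are left unchanged by \<open>glue\<close>.\<close>

lemma state_cut: "map_pmf (cut t) (state P x y (t + k)) = state P x y t"
proof (induction k)
  case 0
  have "map_pmf (cut t) (state P x y t) = map_pmf id (state P x y t)"
    by (rule map_pmf_cong[OF refl]) (auto dest!: state_proper simp: proper_def cut_def)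
  then show ?case by (simp add: pmf.map_id)
next
  case (Suc k)
  have "map_pmf (cut t) (state P x y (Suc (t + k))) =
      map_pmf (\<lambda>e. cut t (fst e)) (extend_pmf P x y (t + k))"
    unfolding state_Suc_glue map_pmf_comp
  proof (rule map_pmf_cong[OF refl])
    fix e assume "e \<in> set_pmf (extend_pmf P x y (t + k))"
    then have "fst e \<in> set_pmf (state P x y (t + k))"
      using map_fst_extend_pmf[of P x y "t + k"] by (metis imageI pmf.set_map)
    then have "proper (t + k) (fst e)" by (rule state_proper)
    then show "cut t (glue e) = cut t (fst e)"
      by (auto simp: proper_def cut_def glue_def split_def)
  qed
  also have "\<dots> = map_pmf (cut t) (map_pmf fst (extend_pmf P x y (t + k)))"
    by (simp add: map_pmf_comp)
  finally show ?case using Suc by (simp add: map_fst_extend_pmf del: state.simps)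
qed

lemma prob_cut: "measure_pmf.prob (state P x y (t + k)) {s. cut t s \<in> S} = measure_pmf.prob (state P x y t) S"
  by (subst state_cut[of t x y k, symmetric]) (simp add: vimage_def)

abbreviation "parse3 t m \<equiv> (case m of (m12, m23, m31) \<Rightarrow>
  (parse (cA2B P) (cB2A P) t m12, parse (cB2C P) (cC2B P) t m23, parse (cC2A P) (cA2C P) t m31))"

definition finished3 :: "bool list \<times> bool list \<times> bool list \<Rightarrow> bool" where
  "finished3 = (\<lambda>(m12, m23, m31). finished (cA2B P) (cB2A P) m12 \<and>
     finished (cB2C P) (cC2B P) m23 \<and> finished (cC2A P) (cA2C P) m31)"

lemma parse3_strs:
  assumes "proper (t + k) s"
  shows "parse3 t (strs s) = cut t s"
  using assms by (auto simp: proper_def strs_def cut_def parse_take prefix_free_codes)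

lemma finished3_strs: "proper t s \<Longrightarrow> terminated P s \<Longrightarrow> finished3 (strs s)"
  by (auto simp: proper_def terminated_def finished3_def finished_def strs_def)

text \<open>After termination all later rounds are empty pairs on every link, which keeps the links
  quiet and the bit strings unchanged.\<close>

lemma terminated_mono:
  assumes "proper (t + k) s" "terminated P (cut t s)"
  shows "terminated P s \<and> strs s = strs (cut t s)"
proof -
  obtain h12 h23 h31 where s: "s = (h12, h23, h31)" by (cases s)
  have *: "quiet c1 c2 h \<and> flat h = flat (take t h)"
    if "quiet c1 c2 (take t h)" "consistent c1 c2 h" for c1 c2 h
  proof -
    from that quiet_consistent_append[OF that(1), of "drop t h"]
    have d: "drop t h = replicate (length (drop t h)) ([], [])" by simp
    have "h = take t h @ replicate (length (drop t h)) ([], [])"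
      unfolding d[symmetric] by simp
    then show ?thesis
      using quiet_extend[OF that(1), of "length (drop t h)"]
      by (metis append.right_neutral flat_append flat_replicate)
  qed
  show ?thesis
    using assms *[of "cA2B P" "cB2A P" h12] *[of "cB2C P" "cC2B P" h23] *[of "cC2A P" "cA2C P" h31]
    by (simp add: s proper_def terminated_def cut_def strs_def)
qed

definition done_prob :: "'a \<Rightarrow> 'b \<Rightarrow> nat \<Rightarrow> (bool list \<times> bool list \<times> bool list) set \<Rightarrow> real" where
  "done_prob x y t M = measure_pmf.prob (state P x y t) {s. terminated P s \<and> strs s \<in> M}"

text \<open>Truncation couples the runs of \<open>t\<close> and \<open>Suc t\<close> rounds, and a
  run that has stopped with some transcript stays stopped with it.\<close>

lemma incseq_done_prob: "incseq (\<lambda>t. done_prob x y t M)"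
proof (rule incseq_SucI)
  fix t
  have "done_prob x y t M = measure_pmf.prob (state P x y (t + 1)) {s. cut t s \<in> {s. terminated P s \<and> strs s \<in> M}}"
    unfolding done_prob_def by (rule prob_cut[symmetric])
  also have "\<dots> \<le> done_prob x y (Suc t) M"
    unfolding done_prob_def add_Suc_right add_0_right One_nat_def
  proof (rule prob_mono_support)
    fix s assume s: "s \<in> set_pmf (state P x y (Suc t))" "s \<in> {s. cut t s \<in> {s. terminated P s \<and> strs s \<in> M}}"
    have "proper (t + 1) s" using state_proper[OF s(1)] by simp
    from terminated_mono[OF this] s(2) show "s \<in> {s. terminated P s \<and> strs s \<in> M}" by simp
  qed
  finally show "done_prob x y t M \<le> done_prob x y (Suc t) M" .
qed

lemma done_prob_lim: "(\<lambda>t. done_prob x y t M) \<longlonglongrightarrow> lim (\<lambda>t. done_prob x y t M)"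
proof -
  have "\<forall>t. done_prob x y t M \<le> 1" by (simp add: done_prob_def)
  from incseq_convergent[OF incseq_done_prob, of x y M, OF this] show ?thesis
    by (metis limI)
qed

lemma ennreal_lim_done_prob: "ennreal (lim (\<lambda>t. done_prob x y t M)) = (SUP t. ennreal (done_prob x y t M))"
proof (rule LIMSEQ_unique)
  show "(\<lambda>t. ennreal (done_prob x y t M)) \<longlonglongrightarrow> ennreal (lim (\<lambda>t. done_prob x y t M))"
    by (intro tendsto_ennrealI done_prob_lim)
  show "(\<lambda>t. ennreal (done_prob x y t M)) \<longlonglongrightarrow> (SUP t. ennreal (done_prob x y t M))"
    by (intro LIMSEQ_SUP) (use incseq_done_prob in \<open>auto simp: incseq_def intro: ennreal_leI\<close>)
qed

text \<open>The values are limits of the probabilities of having stopped with transcript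
  \<open>m\<close>. They sum to 1 exactly when the run terminates with probability 1, the setting of
  \<open>terminating_run\<close>.\<close>

definition transcripts :: "'a \<Rightarrow> 'b \<Rightarrow> (bool list \<times> bool list \<times> bool list) pmf" where
  "transcripts x y = embed_pmf (\<lambda>m. lim (\<lambda>t. done_prob x y t {m}))"

lemma nn_integral_lim_done_prob:
  "(\<integral>\<^sup>+ m. ennreal (lim (\<lambda>t. done_prob x y t {m})) \<partial>count_space M) = (SUP t. ennreal (done_prob x y t M))"
proof -
  have "(\<integral>\<^sup>+ m. ennreal (lim (\<lambda>t. done_prob x y t {m})) \<partial>count_space M) =
      (SUP t. \<integral>\<^sup>+ m. ennreal (done_prob x y t {m}) \<partial>count_space M)"
    unfolding ennreal_lim_done_prob
    by (intro nn_integral_monotone_convergence_SUP)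
       (use incseq_done_prob in \<open>auto simp: incseq_def le_fun_def intro: ennreal_leI\<close>)
  also have "\<dots> = (SUP t. ennreal (done_prob x y t M))"
    unfolding done_prob_def singleton_iff nn_integral_prob_fibre ..
  finally show ?thesis .
qed

lemma lim_done_prob_nonneg: "0 \<le> lim (\<lambda>t. done_prob x y t M)"
  by (rule LIMSEQ_le_const[OF done_prob_lim]) (simp add: done_prob_def)

end

locale terminating_run = valid_prot P for P :: "('a, 'b, 'c) protocol" +
  fixes x :: 'a and y :: 'b
  assumes term_lim: "(\<lambda>t. measure_pmf.prob (state P x y t) {s. terminated P s}) \<longlonglongrightarrow> 1"
begin

lemma total_done_prob: "(SUP t. ennreal (done_prob x y t UNIV)) = 1"
proof -
  have "lim (\<lambda>t. done_prob x y t UNIV) = 1"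
    using term_lim by (simp add: done_prob_def limI)
  then show ?thesis using ennreal_lim_done_prob[of x y UNIV] by simp
qed

lemma pmf_transcripts: "pmf (transcripts x y) m = lim (\<lambda>t. done_prob x y t {m})"
  unfolding transcripts_def
  by (rule pmf_embed_pmf) (simp_all add: lim_done_prob_nonneg nn_integral_lim_done_prob total_done_prob)

lemma emeasure_transcripts: "emeasure (measure_pmf (transcripts x y)) M = (SUP t. ennreal (done_prob x y t M))"
  unfolding nn_integral_pmf[symmetric] pmf_transcripts nn_integral_lim_done_prob ..

lemma transcripts_support:
  assumes "m \<in> set_pmf (transcripts x y)"
  obtains t s where "s \<in> set_pmf (state P x y t)" "terminated P s" "strs s = m"
proof -
  have "emeasure (measure_pmf (transcripts x y)) {m} \<noteq> 0"
    using assms by (simp add: emeasure_pmf_single set_pmf_iff)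
  moreover have "emeasure (measure_pmf (transcripts x y)) {m} = 0"
    if "\<And>t. done_prob x y t {m} = 0"
    unfolding emeasure_transcripts using that by simp
  ultimately obtain t where "done_prob x y t {m} \<noteq> 0"
    by blast
  then have "measure_pmf.prob (state P x y t) {s. terminated P s \<and> strs s = m} \<noteq> 0"
    by (auto simp: done_prob_def)
  then have "set_pmf (state P x y t) \<inter> {s. terminated P s \<and> strs s = m} \<noteq> {}"
    using measure_pmf_zero_iff by blast
  then show ?thesis using that by blast
qed

lemma transcripts_finished: "m \<in> set_pmf (transcripts x y) \<Longrightarrow> finished3 m"
  by (metis transcripts_support finished3_strs state_proper)

text \<open>Ties the limiting law to the round-by-round process. A stopped run decodes to its own
  truncation, which bounds the left mass function by the right one; two probability laws in this
  relation are equal.\<close>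

lemma map_parse_transcripts: "map_pmf (parse3 t) (transcripts x y) = state P x y t"
proof (rule pmf_eq_of_le)
  fix h
  have "ennreal (done_prob x y s {m. parse3 t m = h}) \<le> ennreal (pmf (state P x y t) h)" for s
  proof -
    have "done_prob x y s {m. parse3 t m = h} \<le> done_prob x y (t + s) {m. parse3 t m = h}"
      using incseq_done_prob by (rule incseqD) simp
    also have "\<dots> \<le> measure_pmf.prob (state P x y (t + s)) {r. cut t r \<in> {h}}"
      unfolding done_prob_def
    proof (rule prob_mono_support)
      fix r assume r: "r \<in> set_pmf (state P x y (t + s))"
        "r \<in> {r. terminated P r \<and> strs r \<in> {m. parse3 t m = h}}"
      then show "r \<in> {r. cut t r \<in> {h}}"
        using parse3_strs[OF state_proper[OF r(1)]] by simp
    qed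
    also have "\<dots> = pmf (state P x y t) h"
      unfolding prob_cut by (simp add: measure_pmf_single)
    finally show ?thesis by (rule ennreal_leI)
  qed
  then have "emeasure (measure_pmf (transcripts x y)) {m. parse3 t m = h} \<le> ennreal (pmf (state P x y t) h)"
    unfolding emeasure_transcripts by (rule SUP_least)
  then show "pmf (map_pmf (parse3 t) (transcripts x y)) h \<le> pmf (state P x y t) h"
    by (simp add: pmf_map_eq_prob measure_pmf.emeasure_eq_measure)
qed

lemma out_eq: "out P x y = bind_pmf (transcripts x y) (\<lambda>(m12, m23, m31).
    map_pmf (\<lambda>z. (m12, m23, m31, z)) (outC P m23 m31))" (is "_ = ?r")
proof -
  have "outm P x y = pmf ?r"
  proof
    fix r :: "bool list \<times> bool list \<times> bool list \<times> 'c"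
    obtain m12 m23 m31 z where r: "r = (m12, m23, m31, z)" by (cases r) auto
    define g where "g = (\<lambda>((m12, m23, m31), z :: 'c). (m12 :: bool list, m23 :: bool list, m31 :: bool list, z))"
    have g: "?r = map_pmf g (bind_pmf (transcripts x y) (\<lambda>m. map_pmf (Pair m) (case m of (m12, m23, m31) \<Rightarrow> outC P m23 m31)))"
      by (simp add: g_def map_bind_pmf map_pmf_comp split_def)
    have "inj g" by (auto intro!: injI simp: g_def)
    then have "pmf ?r (g ((m12, m23, m31), z)) = pmf (transcripts x y) (m12, m23, m31) * pmf (outC P m23 m31) z"
      unfolding g by (simp add: pmf_map_inj' pmf_bind_map_Pair)
    then show "outm P x y r = pmf ?r r"
      by (simp add: r g_def outm_def pmf_transcripts done_prob_def)
  qed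
  then show ?thesis unfolding out_def by (simp add: embed_pmf_pmf)
qed

end

section \<open>Independent inputs\<close>

text \<open>Each party's messages depend only on its own input and its own two links, so the
  probability of the histories is a product of one factor per party. This rectangle structure
  underlies both the cut-and-paste argument and the Markov steps within a round.\<close>

lemma state_factorization:
  "\<exists>\<alpha> \<beta> \<gamma>. (\<forall>x h h'. 0 \<le> \<alpha> x h h') \<and> (\<forall>y h h'. 0 \<le> \<beta> y h h') \<and>
     (\<forall>x y h12 h23 h31. pmf (state P x y t) (h12, h23, h31) = \<alpha> x h12 h31 * \<beta> y h12 h23 * (\<gamma> h23 h31 :: real))"
proof (induction t)
  case 0
  show ?case
    by (intro exI[of _ "\<lambda>_ h h'. of_bool (h = [] \<and> h' = [])"] exI[of _ "\<lambda>_ h h'. of_bool (h = [])"]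
        exI[of _ "\<lambda>h h'. of_bool (h = [])"]) (auto simp: indicator_def)
next
  case (Suc t)
  then obtain \<alpha> \<beta> \<gamma> where nn: "\<And>x h h'. 0 \<le> \<alpha> x h h'" "\<And>y h h'. 0 \<le> \<beta> y h h'"
    and fac: "\<And>x y h12 h23 h31. pmf (state P x y t) (h12, h23, h31) = \<alpha> x h12 h31 * \<beta> y h12 h23 * (\<gamma> h23 h31 :: real)"
    by blast
  \<comment> \<open>Each factor absorbs its party's kernel, evaluated at that party's messages in
    the last entries. The value 0 on an empty history reflects that after a round no history is
    empty.\<close>
  define a where "a = (\<lambda>x h12 h31. if h12 = [] \<or> h31 = [] then 0 else \<alpha> x (butlast h12) (butlast h31) *
    pmf (kA P x (butlast h12) (butlast h31)) (fst (last h12), snd (last h31)))"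
  define b where "b = (\<lambda>y h12 h23. if h12 = [] \<or> h23 = [] then 0 else \<beta> y (butlast h12) (butlast h23) *
    pmf (kB P y (butlast h12) (butlast h23)) (snd (last h12), fst (last h23)))"
  define c where "c = (\<lambda>h23 h31. if h23 = [] \<or> h31 = [] then 0 else \<gamma> (butlast h23) (butlast h31) *
    pmf (kC P (butlast h23) (butlast h31)) (snd (last h23), fst (last h31)))"
  have "pmf (state P x y (Suc t)) (h12, h23, h31) = a x h12 h31 * b y h12 h23 * c h23 h31" for x y h12 h23 h31
  proof (cases "h12 = [] \<or> h23 = [] \<or> h31 = []")
    case True
    then have "(h12, h23, h31) \<notin> range glue" by (auto simp: glue_def split: prod.splits)
    then have "pmf (state P x y (Suc t)) (h12, h23, h31) = 0"
      unfolding state_Suc_glue by (intro pmf_map_outside) auto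
    with True show ?thesis by (auto simp: a_def b_def c_def)
  next
    case False
    then obtain g12 g23 g31 a2b b2a b2c c2b c2a a2c where
      h: "h12 = g12 @ [(a2b, b2a)]" "h23 = g23 @ [(b2c, c2b)]" "h31 = g31 @ [(c2a, a2c)]"
      by (metis append_butlast_last_id surj_pair)
    then have "(h12, h23, h31) = glue ((g12, g23, g31), (a2b, a2c), (b2a, b2c), (c2b, c2a))"
      by (simp add: glue_def)
    then show ?thesis unfolding state_Suc_glue
      by (simp add: pmf_map_inj' inj_glue extend_pmf_def pmf_bind_map_Pair round_pmf_def pmf_pair fac)
         (simp add: a_def b_def c_def h)
  qed
  moreover have "0 \<le> a x h h'" "0 \<le> b y h h'" for x y h h'
    using nn by (auto simp: a_def b_def)
  ultimately show ?case by blast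
qed

section \<open>The interaction inequality along the rounds of a protocol\<close>

lemma atom_map: "atom (map_pmf G q) A (G w) = atom q (\<lambda>v. A (G v)) w"
  by (simp add: atom_def vimage_def)

lemma surprisal_map: "surprisal (map_pmf G q) A (G w) = surprisal q (\<lambda>v. A (G v)) w"
  by (simp add: surprisal_def atom_map)

lemma nonneg_mean_map:
  assumes "nonneg_mean (map_pmf G q) D"
  shows "nonneg_mean q (\<lambda>w. D (G w))"
proof -
  obtain g where "integrable (measure_pmf (map_pmf G q)) g" "0 \<le> measure_pmf.expectation (map_pmf G q) g"
    "\<forall>w\<in>set_pmf (map_pmf G q). g w \<le> D w"
    using assms unfolding nonneg_mean_def by blast
  then show ?thesis unfolding nonneg_mean_def
    by (intro exI[of _ "\<lambda>w. g (G w)"]) (auto simp: integrable_map_pmf_eq)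
qed

lemma nonneg_mean_interact_map:
  assumes "nonneg_mean (map_pmf G q) (interact (map_pmf G q) A B C)"
  shows "nonneg_mean q (interact q (\<lambda>v. A (G v)) (\<lambda>v. B (G v)) (\<lambda>v. C (G v)))"
  using nonneg_mean_map[OF assms]
  by (rule nonneg_mean_mono)
     (simp add: interact_def surprisal_map[where A = A] surprisal_map[where A = B] surprisal_map[where A = C] surprisal_map[where A = "\<lambda>v. (_ v, _ v)"] surprisal_map[where A = "\<lambda>v. (_ v, _ v, _ v)"])

lemma surprisal_eq_support:
  assumes "\<And>v. v \<in> set_pmf q \<Longrightarrow> F v = F' v" "w \<in> set_pmf q"
  shows "surprisal q F w = surprisal q F' w"
proof -
  have "atom q F w = atom q F' w"
    unfolding atom_def by (rule prob_cong_support) (simp add: assms)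
  then show ?thesis by (simp add: surprisal_def)
qed

lemma nonneg_mean_interact_cong:
  assumes "nonneg_mean q (interact q A B C)"
    and "\<And>v. v \<in> set_pmf q \<Longrightarrow> A v = A' v" "\<And>v. v \<in> set_pmf q \<Longrightarrow> B v = B' v"
    "\<And>v. v \<in> set_pmf q \<Longrightarrow> C v = C' v"
  shows "nonneg_mean q (interact q A' B' C')"
  using assms(1)
proof (rule nonneg_mean_mono)
  fix w assume w: "w \<in> set_pmf q"
  have "interact q A B C w = interact q A' B' C' w"
    unfolding interact_def
    by (intro arg_cong2[where f = "(+)"] arg_cong2[where f = "(-)"] surprisal_eq_support w) (auto simp: assms)
  then show "interact q A B C w \<le> interact q A' B' C' w" by simp
qed

text \<open>If passing from \<open>(A, C)\<close> to \<open>(A', C')\<close> multiplies the joint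
  probability with each value of \<open>B\<close> by the same factor, summing over these values
  gives the same factor for the marginals, and the products agree.\<close>

lemma markov_of_kernel:
  assumes "\<And>b. measure_pmf.prob q {v. (A' v = A' w \<and> C' v = C' w) \<and> B v = b} =
      \<kappa> * measure_pmf.prob q {v. (A v = A w \<and> C v = C w) \<and> B v = b}" and "0 \<le> \<kappa>"
  shows "atom q (\<lambda>v. (A' v, B v, C' v)) w * atom q (\<lambda>v. (A v, C v)) w =
      atom q (\<lambda>v. (A' v, C' v)) w * atom q (\<lambda>v. (A v, B v, C v)) w"
proof -
  have "atom q (\<lambda>v. (A' v, B v, C' v)) w = \<kappa> * atom q (\<lambda>v. (A v, B v, C v)) w"
    using assms(1)[of "B w"] unfolding atom_def prod.inject by (simp add: conj_ac)
  moreover have "ennreal (atom q (\<lambda>v. (A' v, C' v)) w) = ennreal (\<kappa> * atom q (\<lambda>v. (A v, C v)) w)"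
  proof -
    have "ennreal (atom q (\<lambda>v. (A' v, C' v)) w) =
        (\<integral>\<^sup>+ b. ennreal \<kappa> * ennreal (measure_pmf.prob q {v. (A v = A w \<and> C v = C w) \<and> B v = b}) \<partial>count_space UNIV)"
      using nn_integral_prob_fibre[where q=q and E="\<lambda>v. A' v = A' w \<and> C' v = C' w" and f=B and M=UNIV] assms
      by (simp add: atom_def ennreal_mult)
    also have "\<dots> = ennreal \<kappa> * ennreal (atom q (\<lambda>v. (A v, C v)) w)"
      using nn_integral_prob_fibre[where q=q and E="\<lambda>v. A v = A w \<and> C v = C w" and f=B and M=UNIV]
      by (simp add: nn_integral_cmult atom_def)
    finally show ?thesis using assms(2) by (simp add: ennreal_mult atom_def)
  qed
  then have "atom q (\<lambda>v. (A' v, C' v)) w = \<kappa> * atom q (\<lambda>v. (A v, C v)) w"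
    using assms(2) by (subst (asm) ennreal_inj) (auto simp: atom_def)
  ultimately show ?thesis by simp
qed

text \<open>The factor is the weighted average of \<open>g\<close>. If the total weight vanishes,
  both sums are 0 and the factor is set to 0.\<close>

lemma weighted_sum_factor:
  fixes f g :: "'a \<Rightarrow> real"
  assumes "finite S" "\<And>x. 0 \<le> f x" "\<And>x. 0 \<le> g x"
  obtains \<kappa> where "0 \<le> \<kappa>" "(\<Sum>x\<in>S. f x * g x) = \<kappa> * (\<Sum>x\<in>S. f x)"
proof (cases "(\<Sum>x\<in>S. f x) = 0")
  case True
  then have "\<forall>x\<in>S. f x = 0" using assms by (simp add: sum_nonneg_eq_0_iff)
  then show ?thesis by (intro that[of 0]) auto
next
  case False
  then show ?thesis
    using assms by (intro that[of "(\<Sum>x\<in>S. f x * g x) / (\<Sum>x\<in>S. f x)"]) (auto intro!: divide_nonneg_nonneg sum_nonneg)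
qed

lemma prob_mix:
  assumes "finite I" "I \<noteq> {}"
  shows "measure_pmf.prob (bind_pmf (pmf_of_set I) f) {v. F v = z} = (\<Sum>i\<in>I. pmf (map_pmf F (f i)) z) / card I"
  using assms by (simp add: pmf_map_eq_prob[symmetric] map_bind_pmf pmf_bind_pmf_of_set)

lemma map_extend_pmf:
  "map_pmf (\<lambda>(h, r). (h, f r)) (extend_pmf P x y t) =
    bind_pmf (state P x y t) (\<lambda>h. map_pmf (Pair h) (map_pmf f (round_pmf P x y h)))"
  unfolding extend_pmf_def by (simp add: map_bind_pmf map_pmf_comp)

lemma double_sum_product:
  "(\<Sum>x\<in>S. \<Sum>y\<in>T. f x * g y * c) = sum f S * sum g T * (c :: real)"
  unfolding sum_product unfolding sum_distrib_right ..

text \<open>The round is revealed in three stages: Alice's messages, then Bob's, then Charlie's.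
  Each stage extends two links by an amount that, given these two links so far, is independent of
  the third; the swaps bring this third link into the middle position.\<close>

lemma nonneg_mean_interact_round:
  fixes P :: "('a, 'b, 'c) protocol" and S :: "'a set" and T :: "'b set" and t :: nat
  assumes ST: "finite S" "S \<noteq> {}" "finite T" "T \<noteq> {}"
  defines "R \<equiv> bind_pmf (pmf_of_set (S \<times> T)) (\<lambda>(x, y). extend_pmf P x y t)"
  defines "A0 \<equiv> \<lambda>((h12, h23, h31), (a2b, a2c), (b2a, b2c), (c2b, c2a)). h12"
    and "B0 \<equiv> \<lambda>((h12, h23, h31), (a2b, a2c), (b2a, b2c), (c2b, c2a)). h23"
    and "C0 \<equiv> \<lambda>((h12, h23, h31), (a2b, a2c), (b2a, b2c), (c2b, c2a)). h31"
  assumes base: "nonneg_mean R (interact R A0 B0 C0)"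
  shows "nonneg_mean R (interact R (\<lambda>e. fst (glue e)) (\<lambda>e. fst (snd (glue e))) (\<lambda>e. snd (snd (glue e))))"
proof -
  define A1 :: "(hist \<times> hist \<times> hist) \<times> msgs \<times> msgs \<times> msgs \<Rightarrow> hist \<times> bool list"
    where "A1 = (\<lambda>((h12, h23, h31), (a2b, a2c), (b2a, b2c), (c2b, c2a)). (h12, a2b))"
  define C1 :: "(hist \<times> hist \<times> hist) \<times> msgs \<times> msgs \<times> msgs \<Rightarrow> hist \<times> bool list"
    where "C1 = (\<lambda>((h12, h23, h31), (a2b, a2c), (b2a, b2c), (c2b, c2a)). (h31, a2c))"
  define A2 where "A2 = (\<lambda>e. fst (glue e))"
  define B2 :: "(hist \<times> hist \<times> hist) \<times> msgs \<times> msgs \<times> msgs \<Rightarrow> hist \<times> bool list"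
    where "B2 = (\<lambda>((h12, h23, h31), (a2b, a2c), (b2a, b2c), (c2b, c2a)). (h23, b2c))"
  define B3 where "B3 = (\<lambda>e. fst (snd (glue e)))"
  define C3 where "C3 = (\<lambda>e. snd (snd (glue e)))"
  obtain \<alpha> \<beta> \<gamma> where nn: "\<And>x h h'. 0 \<le> \<alpha> x h h'" "\<And>y h h'. 0 \<le> \<beta> y h h'"
    and fac: "\<And>x y h12 h23 h31. pmf (state P x y t) (h12, h23, h31) = \<alpha> x h12 h31 * \<beta> y h12 h23 * (\<gamma> h23 h31 :: real)"
    using state_factorization[of P t] by blast
  define c where "c = card (S \<times> T)"
  have prob_R: "measure_pmf.prob R {e. (\<lambda>(h, r). (h, f r)) e = ((h12, h23, h31), z)} =
      (\<Sum>x\<in>S. \<Sum>y\<in>T. \<alpha> x h12 h31 * \<beta> y h12 h23 * \<gamma> h23 h31 * pmf (map_pmf f (round_pmf P x y (h12, h23, h31))) z) / c"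
    for f :: "msgs \<times> msgs \<times> msgs \<Rightarrow> 'z" and h12 h23 h31 z
    unfolding R_def
    by (subst prob_mix) (use ST in \<open>auto simp: c_def split_def map_extend_pmf[unfolded split_def] pmf_bind_map_Pair fac sum.cartesian_product\<close>)
  \<comment> \<open>Because the inputs are uniform on a product set, the sum over input pairs splits
    into a sum over Alice's inputs times a sum over Bob's. \<open>P1\<close> to \<open>P3\<close>
    record the effect of revealing one party after another.\<close>
  have P0: "measure_pmf.prob R {e. fst e = (h12, h23, h31)} =
      (\<Sum>x\<in>S. \<alpha> x h12 h31) * (\<Sum>y\<in>T. \<beta> y h12 h23) * \<gamma> h23 h31 / c" for h12 h23 h31
    using prob_R[of "\<lambda>_. ()" h12 h23 h31 "()"]
    unfolding double_sum_product[symmetric] by (simp add: split_def map_pmf_const)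
  have P1: "measure_pmf.prob R {e. fst e = (h12, h23, h31) \<and> fst (snd e) = u} =
      (\<Sum>x\<in>S. \<alpha> x h12 h31 * pmf (kA P x h12 h31) u) * (\<Sum>y\<in>T. \<beta> y h12 h23) * \<gamma> h23 h31 / c" for h12 h23 h31 u
    using prob_R[of fst h12 h23 h31 u]
    unfolding double_sum_product[symmetric]
    by (simp add: split_def round_pmf_def map_fst_pair_pmf mult_ac)
  have P2: "measure_pmf.prob R {e. fst e = (h12, h23, h31) \<and> fst (snd e) = u \<and> fst (snd (snd e)) = v} =
      (\<Sum>x\<in>S. \<alpha> x h12 h31 * pmf (kA P x h12 h31) u) * (\<Sum>y\<in>T. \<beta> y h12 h23 * pmf (kB P y h12 h23) v) * \<gamma> h23 h31 / c"
    for h12 h23 h31 u v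
  proof -
    have "map_pmf (\<lambda>r. (fst r, fst (snd r))) (round_pmf P x y (h12, h23, h31)) =
        pair_pmf (kA P x h12 h31) (kB P y h12 h23)" for x y
      by (simp add: round_pmf_def pair_pmf_def map_bind_pmf map_pmf_def bind_assoc_pmf bind_return_pmf)
    then show ?thesis
      using prob_R[of "\<lambda>r. (fst r, fst (snd r))" h12 h23 h31 "(u, v)"]
      unfolding double_sum_product[symmetric] by (simp add: split_def pmf_pair mult_ac)
  qed
  have P3: "measure_pmf.prob R {e. e = ((h12, h23, h31), u, v, w)} =
      pmf (kC P h23 h31) w * ((\<Sum>x\<in>S. \<alpha> x h12 h31 * pmf (kA P x h12 h31) u) *
      (\<Sum>y\<in>T. \<beta> y h12 h23 * pmf (kB P y h12 h23) v) * \<gamma> h23 h31 / c)" for h12 h23 h31 u v w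
  proof -
    have "measure_pmf.prob R {e. e = ((h12, h23, h31), u, v, w)} =
        (\<Sum>x\<in>S. \<Sum>y\<in>T. (\<alpha> x h12 h31 * pmf (kA P x h12 h31) u) * (\<beta> y h12 h23 * pmf (kB P y h12 h23) v) *
          (\<gamma> h23 h31 * pmf (kC P h23 h31) w)) / c"
      using prob_R[of id h12 h23 h31 "(u, v, w)"]
      by (simp add: split_def round_pmf_def pmf_pair mult_ac pmf.map_id)
    then show ?thesis unfolding double_sum_product by (simp add: mult_ac)
  qed
  \<comment> \<open>Alice's stage: the factor is an average over her inputs and does not involve the
    Bob-Charlie history.\<close>
  have "nonneg_mean R (interact R A1 B0 C1)"
  proof (rule nonneg_mean_interact_step[OF base])
    fix e assume "e \<in> set_pmf R"
    obtain h12 h23 h31 a2b a2c v w where e: "e = ((h12, h23, h31), (a2b, a2c), v, w)"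
      by (metis surj_pair)
    obtain \<kappa> where \<kappa>: "0 \<le> \<kappa>" "(\<Sum>x\<in>S. \<alpha> x h12 h31 * pmf (kA P x h12 h31) (a2b, a2c)) = \<kappa> * (\<Sum>x\<in>S. \<alpha> x h12 h31)"
      by (rule weighted_sum_factor[OF ST(1), of "\<lambda>x. \<alpha> x h12 h31" "\<lambda>x. pmf (kA P x h12 h31) (a2b, a2c)"]) (auto intro: nn)
    show "atom R (\<lambda>v. (A1 v, B0 v, C1 v)) e * atom R (\<lambda>v. (A0 v, C0 v)) e =
        atom R (\<lambda>v. (A1 v, C1 v)) e * atom R (\<lambda>v. (A0 v, B0 v, C0 v)) e"
    proof (rule markov_of_kernel[OF _ \<kappa>(1)])
      fix b
      have "{v. (A1 v = A1 e \<and> C1 v = C1 e) \<and> B0 v = b} = {v. fst v = (h12, b, h31) \<and> fst (snd v) = (a2b, a2c)}"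
        "{v. (A0 v = A0 e \<and> C0 v = C0 e) \<and> B0 v = b} = {v. fst v = (h12, b, h31)}"
        by (auto simp: e A0_def B0_def C0_def A1_def C1_def split_def)
      then show "measure_pmf.prob R {v. (A1 v = A1 e \<and> C1 v = C1 e) \<and> B0 v = b} =
          \<kappa> * measure_pmf.prob R {v. (A0 v = A0 e \<and> C0 v = C0 e) \<and> B0 v = b}"
        by (simp add: P0 P1 \<kappa>(2))
    qed
  qed (auto simp: determines_def A0_def A1_def C0_def C1_def)
  then have "nonneg_mean R (interact R A1 C1 B0)"
    by (rule nonneg_mean_interact_swap23)
  \<comment> \<open>Bob's stage: the untouched link is Charlie-Alice, which so far carries Alice's
    new message only.\<close>
  then have "nonneg_mean R (interact R A2 C1 B2)"
  proof (rule nonneg_mean_interact_step)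
    fix e assume "e \<in> set_pmf R"
    obtain h12 h23 h31 a2b a2c b2a b2c w where e: "e = ((h12, h23, h31), (a2b, a2c), (b2a, b2c), w)"
      by (metis surj_pair)
    obtain \<kappa> where \<kappa>: "0 \<le> \<kappa>" "(\<Sum>y\<in>T. \<beta> y h12 h23 * pmf (kB P y h12 h23) (b2a, b2c)) = \<kappa> * (\<Sum>y\<in>T. \<beta> y h12 h23)"
      by (rule weighted_sum_factor[OF ST(3), of "\<lambda>y. \<beta> y h12 h23" "\<lambda>y. pmf (kB P y h12 h23) (b2a, b2c)"]) (auto intro: nn)
    show "atom R (\<lambda>v. (A2 v, C1 v, B2 v)) e * atom R (\<lambda>v. (A1 v, B0 v)) e =
        atom R (\<lambda>v. (A2 v, B2 v)) e * atom R (\<lambda>v. (A1 v, C1 v, B0 v)) e"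
    proof (rule markov_of_kernel[OF _ \<kappa>(1)])
      fix d
      have "{v. (A2 v = A2 e \<and> B2 v = B2 e) \<and> C1 v = d} =
          {v. fst v = (h12, h23, fst d) \<and> fst (snd v) = (a2b, snd d) \<and> fst (snd (snd v)) = (b2a, b2c)}"
        "{v. (A1 v = A1 e \<and> B0 v = B0 e) \<and> C1 v = d} = {v. fst v = (h12, h23, fst d) \<and> fst (snd v) = (a2b, snd d)}"
        by (auto simp: e B0_def A1_def C1_def A2_def B2_def split_def glue_def)
      then show "measure_pmf.prob R {v. (A2 v = A2 e \<and> B2 v = B2 e) \<and> C1 v = d} =
          \<kappa> * measure_pmf.prob R {v. (A1 v = A1 e \<and> B0 v = B0 e) \<and> C1 v = d}"
        by (simp add: P1 P2 \<kappa>(2))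
    qed
  qed (auto simp: determines_def B0_def A1_def A2_def B2_def glue_def split_def)
  then have "nonneg_mean R (interact R B2 A2 C1)"
    by (rule nonneg_mean_interact_swap12[OF nonneg_mean_interact_swap23])
  \<comment> \<open>Charlie's stage: having no input, he contributes his kernel itself as the
    factor; the untouched Alice-Bob link already has its complete new round.\<close>
  then have "nonneg_mean R (interact R B3 A2 C3)"
  proof (rule nonneg_mean_interact_step)
    fix e assume "e \<in> set_pmf R"
    obtain h12 h23 h31 a2b a2c b2a b2c c2b c2a where e: "e = ((h12, h23, h31), (a2b, a2c), (b2a, b2c), (c2b, c2a))"
      by (metis surj_pair)
    show "atom R (\<lambda>v. (B3 v, A2 v, C3 v)) e * atom R (\<lambda>v. (B2 v, C1 v)) e =
        atom R (\<lambda>v. (B3 v, C3 v)) e * atom R (\<lambda>v. (B2 v, A2 v, C1 v)) e"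
    proof (rule markov_of_kernel)
      show "0 \<le> pmf (kC P h23 h31) (c2b, c2a)" by simp
      fix d
      show "measure_pmf.prob R {v. (B3 v = B3 e \<and> C3 v = C3 e) \<and> A2 v = d} =
          pmf (kC P h23 h31) (c2b, c2a) * measure_pmf.prob R {v. (B2 v = B2 e \<and> C1 v = C1 e) \<and> A2 v = d}"
      \<comment> \<open>The values of \<open>A2\<close> include the new round and are therefore
        nonempty; the last entry supplies the messages exchanged by Alice and Bob.\<close>
      proof (cases d rule: rev_cases)
        case Nil
        then have "A2 v \<noteq> d" for v by (auto simp: A2_def glue_def split_def)
        then show ?thesis by simp
      next
        case (snoc g ab)
        have "{v. (B3 v = B3 e \<and> C3 v = C3 e) \<and> A2 v = d} =
            {v. v = ((g, h23, h31), (fst ab, a2c), (snd ab, b2c), (c2b, c2a))}"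
          "{v. (B2 v = B2 e \<and> C1 v = C1 e) \<and> A2 v = d} =
            {v. fst v = (g, h23, h31) \<and> fst (snd v) = (fst ab, a2c) \<and> fst (snd (snd v)) = (snd ab, b2c)}"
          by (auto simp: e snoc C1_def A2_def B2_def B3_def C3_def split_def glue_def)
        then show ?thesis by (simp only: P2 P3)
      qed
    qed
  qed (auto simp: determines_def C1_def B2_def B3_def C3_def glue_def split_def)
  then show ?thesis
    unfolding A2_def B3_def C3_def by (rule nonneg_mean_interact_swap12)
qed

lemma nonneg_mean_interact_state:
  fixes P :: "('a, 'b, 'c) protocol" and S :: "'a set" and T :: "'b set"
  assumes ST: "finite S" "S \<noteq> {}" "finite T" "T \<noteq> {}"
  shows "nonneg_mean (bind_pmf (pmf_of_set (S \<times> T)) (\<lambda>(x, y). state P x y t))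
    (interact (bind_pmf (pmf_of_set (S \<times> T)) (\<lambda>(x, y). state P x y t)) fst (\<lambda>s. fst (snd s)) (\<lambda>s. snd (snd s)))"
proof (induction t)
  case 0
  have "bind_pmf (pmf_of_set (S \<times> T)) (\<lambda>(x, y). state P x y 0) = return_pmf ([], [], [])"
    by (simp add: split_def)
  then show ?case
    using nonneg_mean_zero by (rule_tac nonneg_mean_mono) (auto simp: interact_def surprisal_def atom_def)
next
  case (Suc t)
  define R where "R = bind_pmf (pmf_of_set (S \<times> T)) (\<lambda>(x, y). extend_pmf P x y t)"
  have "map_pmf fst R = bind_pmf (pmf_of_set (S \<times> T)) (\<lambda>(x, y). state P x y t)"
    unfolding R_def by (simp add: map_bind_pmf split_def map_fst_extend_pmf)
  with Suc have "nonneg_mean (map_pmf fst R) (interact (map_pmf fst R) fst (\<lambda>s. fst (snd s)) (\<lambda>s. snd (snd s)))"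
    by simp
  then have "nonneg_mean R (interact R (\<lambda>e. fst (fst e)) (\<lambda>e. fst (snd (fst e))) (\<lambda>e. snd (snd (fst e))))"
    by (rule nonneg_mean_interact_map)
  then have *: "nonneg_mean R (interact R (\<lambda>e. fst (glue e)) (\<lambda>e. fst (snd (glue e))) (\<lambda>e. snd (snd (glue e))))"
    unfolding R_def
    by (intro nonneg_mean_interact_round[OF ST]) (simp add: split_def)
  define Q where "Q = map_pmf glue R"
  have Q: "Q = bind_pmf (pmf_of_set (S \<times> T)) (\<lambda>(x, y). state P x y (Suc t))"
    unfolding Q_def R_def by (simp add: map_bind_pmf split_def state_Suc_glue del: state.simps)
  \<comment> \<open>Since \<open>glue\<close> is injective, the old histories and new messages can
    be read off the new state, which transports the inequality from \<open>R\<close> to the law of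
    the state.\<close>
  have R: "R = map_pmf (inv glue) Q"
    by (simp add: Q_def map_pmf_comp inj_glue pmf.map_ident)
  have "nonneg_mean Q (interact Q fst (\<lambda>s. fst (snd s)) (\<lambda>s. snd (snd s)))"
    by (rule nonneg_mean_interact_cong[OF nonneg_mean_interact_map[OF *[unfolded R]]])
       (auto simp: Q_def inj_glue)
  then show ?case unfolding Q .
qed

section \<open>Consequences of security\<close>

lemma ent_map_pmf: "ent (map_pmf F q) = cond_entropy q F (\<lambda>_. ())"
proof -
  have "ent (map_pmf F q) = (\<integral>\<^sup>+ v. ennreal (- log 2 (pmf (map_pmf F q) v)) \<partial>measure_pmf (map_pmf F q))"
    unfolding ent_def nn_integral_measure_pmf[of "map_pmf F q"]
    by (intro nn_integral_cong) (simp add: ennreal_mult'[symmetric])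
  also have "\<dots> = (\<integral>\<^sup>+ w. ennreal (surprisal q F w) \<partial>measure_pmf q)"
    by (simp add: pmf_map_eq_prob surprisal_def atom_def)
  finally show ?thesis by (simp add: cond_entropy_uncond)
qed

lemma prob_J:
  "measure_pmf.prob (J P p) {w. F (snd w) = a \<and> fst w = xy} =
    pmf p xy * measure_pmf.prob (out P (fst xy) (snd xy)) {r. F r = a}"
proof -
  have "map_pmf (\<lambda>w. (fst w, F (snd w))) (J P p) =
      bind_pmf p (\<lambda>xy. map_pmf (Pair xy) (map_pmf F (out P (fst xy) (snd xy))))"
    unfolding J_def by (simp add: map_bind_pmf map_pmf_comp)
  then have "pmf (map_pmf (\<lambda>w. (fst w, F (snd w))) (J P p)) (xy, a) =
      pmf p xy * pmf (map_pmf F (out P (fst xy) (snd xy))) a"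
    by (simp add: pmf_bind_map_Pair)
  then show ?thesis by (simp add: pmf_map_eq_prob conj_commute)
qed

text \<open>When \<open>B\<close> and \<open>C\<close> together single out one input pair, the
  Markov chain F - B - C identifies the law of \<open>F\<close> at this pair with its conditional
  law given \<open>B\<close> alone.\<close>

lemma markov_kernel:
  assumes mk: "markov (J P p) (\<lambda>w. F (snd w)) B C"
    and xy: "xy \<in> set_pmf p"
    and fib: "\<And>w. w \<in> set_pmf (J P p) \<Longrightarrow> B w = b \<and> C w = c \<longleftrightarrow> fst w = xy"
  shows "pmf (map_pmf F (out P (fst xy) (snd xy))) a =
    measure_pmf.prob (J P p) {w. F (snd w) = a \<and> B w = b} / measure_pmf.prob (J P p) {w. B w = b}"
proof -
  let ?J = "measure_pmf.prob (J P p)"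
  have p: "pmf p xy > 0" using xy by (simp add: pmf_positive)
  have 1: "?J {w. F (snd w) = a \<and> B w = b \<and> C w = c} = pmf p xy * pmf (map_pmf F (out P (fst xy) (snd xy))) a"
    unfolding pmf_map_eq_prob prob_J[symmetric] by (rule prob_cong_support) (use fib in auto)
  have 2: "?J {w. B w = b \<and> C w = c} = pmf p xy"
  proof -
    have "?J {w. B w = b \<and> C w = c} = ?J {w. (\<lambda>_. ()) (snd w) = () \<and> fst w = xy}"
      by (rule prob_cong_support) (use fib in auto)
    also have "\<dots> = pmf p xy" by (subst prob_J) simp
    finally show ?thesis .
  qed
  have "pmf p xy \<le> ?J {w. B w = b}"
    unfolding 2[symmetric] by (rule prob_mono_support) auto
  then have "?J {w. B w = b} > 0" using p by simp
  moreover have "?J {w. F (snd w) = a \<and> B w = b \<and> C w = c} * ?J {w. B w = b} =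
      ?J {w. F (snd w) = a \<and> B w = b} * ?J {w. B w = b \<and> C w = c}"
    using mk unfolding markov_def by blast
  ultimately show ?thesis using p unfolding 1 2 by (simp add: field_simps)
qed

lemma length_sumf [simp]: "length (sumf x y) = min (length x) (length y)"
  by (simp add: sumf_def)

lemma nth_sumf: "i < length x \<Longrightarrow> i < length y \<Longrightarrow> sumf x y ! i = of_bool (x ! i) + of_bool (y ! i)"
  by (simp add: sumf_def)

lemma sumf_cancel_left:
  assumes "sumf x y = sumf x y'" "length y = length x" "length y' = length x"
  shows "y = y'"
proof (rule nth_equalityI)
  fix i assume "i < length y"
  moreover have "sumf x y ! i = sumf x y' ! i" using assms(1) by simp
  ultimately have "of_bool (x ! i) + of_bool (y ! i) = (of_bool (x ! i) + of_bool (y' ! i) :: nat)"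
    using assms(2,3) by (simp add: nth_sumf)
  then show "y ! i = y' ! i" by (cases "y ! i"; cases "y' ! i") simp_all
qed (use assms in simp)

lemma sumf_commute: "length x = length y \<Longrightarrow> sumf x y = sumf y x"
  by (rule nth_equalityI) (simp_all add: nth_sumf)

lemma sumf_cancel_right:
  "sumf x y = sumf x' y \<Longrightarrow> length x = length y \<Longrightarrow> length x' = length y \<Longrightarrow> x = x'"
  using sumf_cancel_left[of y x x'] by (simp add: sumf_commute)

lemma sumf_complement: "sumf x (map Not x) = replicate (length x) 1"
  by (rule nth_equalityI) (simp_all add: nth_sumf)

text \<open>Two runs that agree on both links of Alice may exchange her input, because only her
  factor in \<open>state_factorization\<close> sees it and that factor is nonzero in both runs; the
  same holds for Bob.\<close>

lemma cut_and_paste: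
  assumes "terminating_run P x y" "terminating_run P x' y'" "terminating_run P x'' y''"
    and m: "(m12, m23, m31) \<in> set_pmf (valid_prot.transcripts P x y)"
    and m': "(m12', m23', m31') \<in> set_pmf (valid_prot.transcripts P x' y')"
    and eq: "x'' = x' \<and> y'' = y \<and> m12' = m12 \<and> m31' = m31 \<or> x'' = x \<and> y'' = y' \<and> m12' = m12 \<and> m23' = m23"
  shows "(m12, m23, m31) \<in> set_pmf (valid_prot.transcripts P x'' y'')"
proof -
  interpret r: terminating_run P x y by fact
  interpret r': terminating_run P x' y' by fact
  interpret r'': terminating_run P x'' y'' by fact
  obtain t h where h: "h \<in> set_pmf (state P x y t)" "terminated P h" "strs h = (m12, m23, m31)"
    using r.transcripts_support[OF m] .
  obtain h12 h23 h31 where hh: "h = (h12, h23, h31)" by (cases h)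
  have len: "r.proper (t + 0) h" using r.state_proper[OF h(1)] by simp
  have "r.parse3 t (m12, m23, m31) = r.cut t h"
    using r.parse3_strs[OF len] by (simp add: h(3))
  also have "\<dots> = h"
    using len by (simp add: hh r.cut_def r.proper_def)
  finally have parse: "r.parse3 t (m12, m23, m31) = h" .
  \<comment> \<open>Only the first \<open>t\<close> rounds of the second run matter, where
    \<open>t\<close> is a time at which the first run has stopped.\<close>
  have "r.parse3 t (m12', m23', m31') \<in> set_pmf (state P x' y' t)"
    unfolding r'.map_parse_transcripts[symmetric, of t] set_map_pmf using m' by (rule imageI)
  moreover obtain g12 g23 g31 where g: "r.parse3 t (m12', m23', m31') = (g12, g23, g31)"
    by (metis prod_cases3)
  ultimately have g0: "pmf (state P x' y' t) (g12, g23, g31) \<noteq> 0"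
    by (simp add: set_pmf_iff)
  obtain \<alpha> \<beta> \<gamma> where fac: "\<And>x y h12 h23 h31. pmf (state P x y t) (h12, h23, h31) = \<alpha> x h12 h31 * \<beta> y h12 h23 * (\<gamma> h23 h31 :: real)"
    using state_factorization[of P t] by blast
  have h0: "pmf (state P x y t) (h12, h23, h31) \<noteq> 0"
    using h(1) by (simp add: set_pmf_iff hh)
  have "pmf (state P x'' y'' t) (h12, h23, h31) \<noteq> 0"
    using eq g parse g0 h0 unfolding fac by (auto simp: hh)
  then have "h \<in> set_pmf (state P x'' y'' t)" by (simp add: hh set_pmf_iff)
  then have "0 < r.done_prob x'' y'' t {(m12, m23, m31)}"
    unfolding r.done_prob_def using h by (intro measure_pmf_posI[of h]) auto
  also have "\<dots> \<le> pmf (valid_prot.transcripts P x'' y'') (m12, m23, m31)"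
    unfolding r''.pmf_transcripts
    by (rule incseq_le[OF r.incseq_done_prob r.done_prob_lim])
  finally show ?thesis by (simp add: set_pmf_iff)
qed

definition words :: "nat \<Rightarrow> bool list set" where "words n = {x. length x = n}"

lemma finite_words: "finite (words n)"
  and card_words: "card (words n) = 2 ^ n"
  using finite_lists_length_eq[of "UNIV :: bool set" n] card_lists_length_eq[of "UNIV :: bool set" n]
  by (simp_all add: words_def)

lemma words_nonempty: "words n \<noteq> {}"
  using card_words[of n] by (metis card.empty power_not_zero zero_neq_numeral)

lemma prob_uniform_inputs:
  assumes "finite I" "I \<noteq> {}"
  shows "measure_pmf.prob (bind_pmf (pmf_of_set I) f) {v. Q v} = (\<Sum>i\<in>I. measure_pmf.prob (f i) {v. Q v}) / card I"
  using prob_mix[OF assms, of f Q True] by (simp add: pmf_map_eq_prob)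

text \<open>\<open>B\<close> has the same law for all inputs and is thus independent of the chosen
  input; given \<open>B\<close>, the value of \<open>g\<close> still has probability
  \<open>k / card I\<close>.\<close>

lemma cond_surprisal_uniform_inputs:
  assumes I: "finite I" "I \<noteq> {}"
    and G: "\<And>i m. i \<in> I \<Longrightarrow> m \<in> set_pmf (f i) \<Longrightarrow> g m = G i"
    and B: "\<And>i. i \<in> I \<Longrightarrow> map_pmf B (f i) = r"
    and card: "\<And>i. i \<in> I \<Longrightarrow> card {j\<in>I. G j = G i} = k"
    and m: "m \<in> set_pmf (bind_pmf (pmf_of_set I) f)"
  shows "cond_surprisal (bind_pmf (pmf_of_set I) f) g B m = log 2 (card I / k)"
proof -
  let ?q = "bind_pmf (pmf_of_set I) f"
  obtain i where i: "i \<in> I" "m \<in> set_pmf (f i)" using m I by auto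
  have fib: "measure_pmf.prob (f j) {v. B v = B m} = pmf r (B m)" if "j \<in> I" for j
    by (simp add: B[OF that, symmetric] pmf_map_eq_prob)
  have "atom ?q B m = pmf r (B m)"
    unfolding atom_def prob_uniform_inputs[OF I] using I by (simp add: fib)
  moreover have "atom ?q (\<lambda>v. (g v, B v)) m = pmf r (B m) * k / card I"
  proof -
    have "measure_pmf.prob (f j) {v. (g v, B v) = (g m, B m)} = (if G j = G i then pmf r (B m) else 0)"
      if j: "j \<in> I" for j
    proof -
      have "measure_pmf.prob (f j) {v. (g v, B v) = (g m, B m)} =
          measure_pmf.prob (f j) {v. G j = G i \<and> B v = B m}"
        by (rule prob_cong_support) (use G[OF j] G[OF i] in auto)
      then show ?thesis by (simp add: fib[OF j])
    qed
    then have "(\<Sum>j\<in>I. measure_pmf.prob (f j) {v. (g v, B v) = (g m, B m)}) =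
        (\<Sum>j\<in>I. if G j = G i then pmf r (B m) else 0)"
      by (intro sum.cong) auto
    also have "\<dots> = pmf r (B m) * k"
      using I(1) card[OF i(1)] by (simp add: sum.If_cases Int_def)
    finally show ?thesis unfolding atom_def prob_uniform_inputs[OF I] by simp
  qed
  moreover have "0 < atom ?q B m" "0 < atom ?q (\<lambda>v. (g v, B v)) m"
    using m by (rule atom_pos)+
  ultimately have "cond_surprisal ?q g B m = log 2 (pmf r (B m)) - log 2 (pmf r (B m) * k / card I)"
    and pos: "0 < pmf r (B m)" "0 < pmf r (B m) * k / card I"
    by (simp_all add: cond_surprisal_def surprisal_def)
  moreover have "pmf r (B m) / (pmf r (B m) * k / card I) = card I / k"
    using pos by (simp add: field_simps)
  ultimately show ?thesis by (metis log_divide_pos)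
qed

section \<open>Security of sum protocols: privacy, correctness and recovery of inputs\<close>

locale secure_sum =
  fixes n :: nat and p :: "(bool list \<times> bool list) pmf" and P :: "(bool list, bool list, nat list) protocol"
  assumes supp: "set_pmf p = words n \<times> words n" and sec: "secure P p sumf"

sublocale secure_sum \<subseteq> valid_prot P
  by unfold_locales (use sec in \<open>simp add: secure_def\<close>)

context secure_sum
begin

lemma run: "x \<in> words n \<Longrightarrow> y \<in> words n \<Longrightarrow> terminating_run P x y"
  by unfold_locales (use sec supp in \<open>auto simp: secure_def terminates_def\<close>)

lemma out_correct:
  assumes "x \<in> words n" "y \<in> words n" "r \<in> set_pmf (out P x y)"
  shows "snd (snd (snd r)) = sumf x y"
proof -
  have "\<forall>(x, y)\<in>set_pmf p. \<forall>r\<in>set_pmf (out P x y). snd (snd (snd r)) = sumf x y"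
    using sec by (simp add: secure_def)
  with assms supp show ?thesis by blast
qed

lemma map_out:
  assumes "x \<in> words n" "y \<in> words n"
  shows "map_pmf (\<lambda>r. F (fst r) (fst (snd r)) (fst (snd (snd r)))) (out P x y) =
    map_pmf (\<lambda>(m12, m23, m31). F m12 m23 m31) (transcripts x y)"
proof -
  interpret terminating_run P x y using assms by (rule run)
  show ?thesis unfolding out_eq
    by (simp add: map_bind_pmf split_def map_pmf_comp map_pmf_const) (simp add: map_pmf_def)
qed

lemma J_support:
  assumes "w \<in> set_pmf (J P p)"
  shows "fst w \<in> words n \<times> words n" "RZ w = sumf (RX w) (RY w)"
proof -
  from assms have "w \<in> (\<Union>xy\<in>set_pmf p. Pair xy ` set_pmf (out P (fst xy) (snd xy)))"
    unfolding J_def by (simp only: set_bind_pmf set_map_pmf)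
  then obtain xy r where w: "xy \<in> set_pmf p" "r \<in> set_pmf (out P (fst xy) (snd xy))" "w = (xy, r)"
    by blast
  show xy: "fst w \<in> words n \<times> words n" using w(1,3) unfolding supp by simp
  have "fst xy \<in> words n" "snd xy \<in> words n" using xy w(3) by (simp_all add: mem_Times_iff)
  from out_correct[OF this w(2)] show "RZ w = sumf (RX w) (RY w)"
    by (simp add: w(3) RZ_def RX_def RY_def)
qed

text \<open>Together with \<open>RX\<close>, the pair \<open>(RY, RZ)\<close> singles out the
  inputs, so Alice's Markov condition expresses the law of her transcripts at \<open>(x, y)\<close>
  through \<open>x\<close> alone. The full support makes every such pair available.\<close>

lemma alice_privacy:
  assumes "x \<in> words n" "y \<in> words n" "y' \<in> words n"
  shows "map_pmf (\<lambda>(m12, m23, m31). (m12, m31)) (transcripts x y) =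
    map_pmf (\<lambda>(m12, m23, m31). (m12, m31)) (transcripts x y')"
proof -
  let ?F = "\<lambda>r. (fst r, fst (snd (snd r)))"
  have mk: "markov (J P p) (\<lambda>w. ?F (snd w)) RX (\<lambda>w. (RY w, RZ w))"
    using sec by (simp add: secure_def M12_def M31_def)
  have "pmf (map_pmf ?F (out P x y)) a = measure_pmf.prob (J P p) {w. ?F (snd w) = a \<and> RX w = x} / measure_pmf.prob (J P p) {w. RX w = x}"
    if y: "y \<in> words n" for y a
    using markov_kernel[OF mk, of "(x, y)" x "(y, sumf x y)" a] assms(1) y supp
    by (auto simp: J_support RX_def RY_def prod_eq_iff)
  then have "map_pmf ?F (out P x y) = map_pmf ?F (out P x y')"
    using assms by (intro pmf_eqI) simp
  then show ?thesis
    using map_out[of x y "\<lambda>a b c. (a, c)"] map_out[of x y' "\<lambda>a b c. (a, c)"] assms by simp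
qed

lemma bob_privacy:
  assumes "x \<in> words n" "x' \<in> words n" "y \<in> words n"
  shows "map_pmf (\<lambda>(m12, m23, m31). (m12, m23)) (transcripts x y) =
    map_pmf (\<lambda>(m12, m23, m31). (m12, m23)) (transcripts x' y)"
proof -
  let ?F = "\<lambda>r. (fst r, fst (snd r))"
  have mk: "markov (J P p) (\<lambda>w. ?F (snd w)) RY (\<lambda>w. (RX w, RZ w))"
    using sec by (simp add: secure_def M12_def M23_def)
  have "pmf (map_pmf ?F (out P x y)) a = measure_pmf.prob (J P p) {w. ?F (snd w) = a \<and> RY w = y} / measure_pmf.prob (J P p) {w. RY w = y}"
    if x: "x \<in> words n" for x a
    using markov_kernel[OF mk, of "(x, y)" y "(x, sumf x y)" a] assms(3) x supp
    by (auto simp: J_support RX_def RY_def prod_eq_iff)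
  then have "map_pmf ?F (out P x y) = map_pmf ?F (out P x' y)"
    using assms by (intro pmf_eqI) simp
  then show ?thesis
    using map_out[of x y "\<lambda>a b c. (a, b)"] map_out[of x' y "\<lambda>a b c. (a, b)"] assms by simp
qed

lemma charlie_privacy:
  assumes "x \<in> words n" "x' \<in> words n" "y \<in> words n" "y' \<in> words n" "sumf x y = sumf x' y'"
  shows "map_pmf (\<lambda>(m12, m23, m31). (m23, m31)) (transcripts x y) =
    map_pmf (\<lambda>(m12, m23, m31). (m23, m31)) (transcripts x' y')"
proof -
  let ?F = "\<lambda>r. (fst (snd r), fst (snd (snd r)))"
  have mk: "markov (J P p) (\<lambda>w. ?F (snd w)) RZ (\<lambda>w. (RX w, RY w))"
    using sec by (simp add: secure_def M31_def M23_def)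
  have "pmf (map_pmf ?F (out P x y)) a = measure_pmf.prob (J P p) {w. ?F (snd w) = a \<and> RZ w = sumf x y} / measure_pmf.prob (J P p) {w. RZ w = sumf x y}"
    if "x \<in> words n" "y \<in> words n" for x y a
    using markov_kernel[OF mk, of "(x, y)" "sumf x y" "(x, y)" a] that supp
    by (auto simp: J_support RX_def RY_def prod_eq_iff)
  then have "map_pmf ?F (out P x y) = map_pmf ?F (out P x' y')"
    using assms by (intro pmf_eqI) simp
  then show ?thesis
    using map_out[of x y "\<lambda>a b c. (b, c)"] map_out[of x' y' "\<lambda>a b c. (b, c)"] assms by simp
qed

lemma map_Not_words: "x \<in> words n \<Longrightarrow> map Not x \<in> words n"
  by (simp add: words_def)

lemma sumf_complement_eq: "x \<in> words n \<Longrightarrow> x' \<in> words n \<Longrightarrow> sumf x (map Not x) = sumf x' (map Not x')"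
  by (simp add: sumf_complement words_def)

text \<open>Alice's privacy replaces \<open>y\<close> by the complement of \<open>x\<close>. The sum
  is then the all-ones word whatever \<open>x\<close> is, so Charlie's privacy permits a change of
  \<open>x\<close>, and Alice's privacy finally restores the desired second input.\<close>

lemma M31_law:
  assumes "x \<in> words n" "x' \<in> words n" "y \<in> words n" "y' \<in> words n"
  shows "map_pmf (\<lambda>m. snd (snd m)) (transcripts x y) = map_pmf (\<lambda>m. snd (snd m)) (transcripts x' y')"
proof -
  have A: "map_pmf (\<lambda>m. snd (snd m)) (transcripts x y) = map_pmf (\<lambda>m. snd (snd m)) (transcripts x y')"
    if "x \<in> words n" "y \<in> words n" "y' \<in> words n" for x y y'
    using arg_cong[OF alice_privacy[OF that], of "map_pmf snd"] by (simp add: map_pmf_comp split_def)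
  have C: "map_pmf (\<lambda>m. snd (snd m)) (transcripts x (map Not x)) = map_pmf (\<lambda>m. snd (snd m)) (transcripts x' (map Not x'))"
    using arg_cong[OF charlie_privacy[OF assms(1,2) map_Not_words map_Not_words sumf_complement_eq, OF assms(1,2,1,2)], of "map_pmf snd"]
    by (simp add: map_pmf_comp split_def)
  show ?thesis
    using A[OF assms(1,3) map_Not_words[OF assms(1)]] C A[OF assms(2) map_Not_words[OF assms(2)] assms(4)] by simp
qed

lemma M23_law:
  assumes "x \<in> words n" "x' \<in> words n" "y \<in> words n" "y' \<in> words n"
  shows "map_pmf (\<lambda>m. fst (snd m)) (transcripts x y) = map_pmf (\<lambda>m. fst (snd m)) (transcripts x' y')"
proof -
  have B: "map_pmf (\<lambda>m. fst (snd m)) (transcripts x y) = map_pmf (\<lambda>m. fst (snd m)) (transcripts x' y)"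
    if "x \<in> words n" "x' \<in> words n" "y \<in> words n" for x x' y
    using arg_cong[OF bob_privacy[OF that], of "map_pmf snd"] by (simp add: map_pmf_comp split_def)
  have C: "map_pmf (\<lambda>m. fst (snd m)) (transcripts x (map Not x)) = map_pmf (\<lambda>m. fst (snd m)) (transcripts x' (map Not x'))"
    if "x \<in> words n" "x' \<in> words n" for x x'
    using arg_cong[OF charlie_privacy[OF that(1,2) map_Not_words map_Not_words sumf_complement_eq, OF that(1,2,1,2)], of "map_pmf fst"]
    by (simp add: map_pmf_comp split_def)
  \<comment> \<open>Here the complementary pairs are needed in the form
    \<open>(map Not y, y)\<close>, obtained from \<open>(x, map Not x)\<close> because complementing
    is an involution.\<close>
  have inv: "map Not (map Not v) = v" for v by (induction v) auto
  show ?thesis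
    using B[OF assms(1) map_Not_words[OF assms(3)] assms(3)] B[OF map_Not_words[OF assms(4)] assms(2,4)]
      C[OF map_Not_words[OF assms(3)] map_Not_words[OF assms(4)]] by (simp only: inv)
qed

lemma M12_law:
  assumes "x \<in> words n" "x' \<in> words n" "y \<in> words n" "y' \<in> words n"
  shows "map_pmf fst (transcripts x y) = map_pmf fst (transcripts x' y')"
  using arg_cong[OF alice_privacy[OF assms(1,3,4)], of "map_pmf fst"]
    arg_cong[OF bob_privacy[OF assms(1,2,4)], of "map_pmf fst"]
  by (simp add: map_pmf_comp split_def)

text \<open>The law of Charlie's output depends only on his two transcripts, so any value in its
  support has to be correct for both input pairs.\<close>

lemma sum_determined:
  assumes "x \<in> words n" "x' \<in> words n" "y \<in> words n" "y' \<in> words n"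
    and m: "(m12, m23, m31) \<in> set_pmf (transcripts x y)" "(m12', m23, m31) \<in> set_pmf (transcripts x' y')"
  shows "sumf x y = sumf x' y'"
proof -
  obtain z where z: "z \<in> set_pmf (outC P m23 m31)" using set_pmf_not_empty[of "outC P m23 m31"] by blast
  have out: "(m12, m23, m31, z) \<in> set_pmf (out P x y)"
    if "x \<in> words n" "y \<in> words n" "(m12, m23, m31) \<in> set_pmf (transcripts x y)" for x y m12
    unfolding terminating_run.out_eq[OF run[OF that(1,2)]] using that z by force
  show ?thesis
    using out_correct[OF assms(1,3) out[OF assms(1,3) m(1)]] out_correct[OF assms(2,4) out[OF assms(2,4) m(2)]]
    by simp
qed

text \<open>Cut and paste makes the same transcripts possible after one input is exchanged;
  Charlie's output then forces equal sums, and cancelling the common input gives the claim.\<close>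

lemma input_determined:
  assumes "x \<in> words n" "x' \<in> words n" "y \<in> words n" "y' \<in> words n"
    and m: "(m12, m23, m31) \<in> set_pmf (transcripts x y)" "(m12, m23', m31') \<in> set_pmf (transcripts x' y')"
  shows "m31' = m31 \<Longrightarrow> x = x'" and "m23' = m23 \<Longrightarrow> y = y'"
proof -
  assume "m31' = m31"
  then have "(m12, m23, m31) \<in> set_pmf (transcripts x' y)"
    by (intro cut_and_paste[OF run[OF assms(1,3)] run[OF assms(2,4)] run[OF assms(2,3)] m]) simp
  from sum_determined[OF assms(1,2,3,3) m(1) this] show "x = x'"
    using assms by (intro sumf_cancel_right) (auto simp: words_def)
next
  assume "m23' = m23"
  then have "(m12, m23, m31) \<in> set_pmf (transcripts x y')"
    by (intro cut_and_paste[OF run[OF assms(1,3)] run[OF assms(2,4)] run[OF assms(1,4)] m]) simp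
  from sum_determined[OF assms(1,1,3,4) m(1) this] show "y = y'"
    using assms by (intro sumf_cancel_left[of x]) (auto simp: words_def)
qed

text \<open>Turns Alice's input into a random variable on the space of transcripts. On the support
  the choice is unique, because full transcripts determine both inputs.\<close>

definition xof :: "bool list \<times> bool list \<times> bool list \<Rightarrow> bool list" where
  "xof m = (SOME x. x \<in> words n \<and> (\<exists>y\<in>words n. m \<in> set_pmf (transcripts x y)))"

definition yof :: "bool list \<times> bool list \<times> bool list \<Rightarrow> bool list" where
  "yof m = (SOME y. y \<in> words n \<and> (\<exists>x\<in>words n. m \<in> set_pmf (transcripts x y)))"

lemma xof_yof:
  assumes "x \<in> words n" "y \<in> words n" "m \<in> set_pmf (transcripts x y)"
  shows "xof m = x" "yof m = y"
proof -
  obtain m12 m23 m31 where m: "m = (m12, m23, m31)" by (cases m)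
  show "xof m = x" unfolding xof_def
    by (rule some_equality) (use assms input_determined(1) in \<open>unfold m, blast+\<close>)
  show "yof m = y" unfolding yof_def
    by (rule some_equality) (use assms input_determined(2) in \<open>unfold m, blast+\<close>)
qed

definition mixture :: "(bool list \<times> bool list) set \<Rightarrow> (bool list \<times> bool list \<times> bool list) pmf" where
  "mixture I = bind_pmf (pmf_of_set I) (\<lambda>xy. transcripts (fst xy) (snd xy))"

text \<open>A law common to all inputs survives any averaging over inputs, so it can be computed
  under a convenient uniform mixture and then used under \<open>p\<close>.\<close>

lemma map_mixture:
  assumes "finite I" "I \<noteq> {}" "I \<subseteq> words n \<times> words n"
    and "\<And>x y. x \<in> words n \<Longrightarrow> y \<in> words n \<Longrightarrow> map_pmf (\<lambda>(m12, m23, m31). F m12 m23 m31) (transcripts x y) = r"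
  shows "map_pmf (\<lambda>(m12, m23, m31). F m12 m23 m31) (mixture I) = r"
    and "map_pmf (\<lambda>w. F (M12 w) (M23 w) (M31 w)) (J P p) = r"
proof -
  have "map_pmf (\<lambda>(m12, m23, m31). F m12 m23 m31) (mixture I) = bind_pmf (pmf_of_set I) (\<lambda>_. r)"
    unfolding mixture_def map_bind_pmf by (rule bind_pmf_cong) (use assms in auto)
  then show "map_pmf (\<lambda>(m12, m23, m31). F m12 m23 m31) (mixture I) = r" by simp
  have "map_pmf (\<lambda>w. F (M12 w) (M23 w) (M31 w)) (J P p) = bind_pmf p (\<lambda>_. r)"
    unfolding J_def map_bind_pmf map_pmf_comp M12_def M23_def M31_def snd_conv
    by (rule bind_pmf_cong) (use assms(4) supp in \<open>auto simp: map_out[where F = F]\<close>)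
  then show "map_pmf (\<lambda>w. F (M12 w) (M23 w) (M31 w)) (J P p) = r" by simp
qed

end

section \<open>The sum function\<close>

text \<open>A section of the sum: digit 0 comes from the bits (0,0), digit 1 from (0,1) and digit 2
  from (1,1). Uniform inputs in its image make the sum uniform on ternary words.\<close>

definition sum_inputs :: "nat list \<Rightarrow> bool list \<times> bool list" where
  "sum_inputs z = (map (\<lambda>k. k = 2) z, map (\<lambda>k. 1 \<le> k) z)"

definition ternary_inputs :: "nat \<Rightarrow> (bool list \<times> bool list) set" where
  "ternary_inputs n = sum_inputs ` {z. set z \<subseteq> {0, 1, 2} \<and> length z = n}"

lemma sumf_sum_inputs:
  assumes "set z \<subseteq> {0, 1, 2}"
  shows "sumf (fst (sum_inputs z)) (snd (sum_inputs z)) = z"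
proof (rule nth_equalityI)
  fix i assume "i < length (sumf (fst (sum_inputs z)) (snd (sum_inputs z)))"
  then have i: "i < length z" by (simp add: sum_inputs_def)
  then have "z ! i \<in> {0, 1, 2}" using assms nth_mem by blast
  with i show "sumf (fst (sum_inputs z)) (snd (sum_inputs z)) ! i = z ! i"
    by (auto simp: sum_inputs_def nth_sumf)
qed (simp add: sum_inputs_def)

lemma inj_on_sum_inputs: "inj_on sum_inputs {z. set z \<subseteq> {0, 1, 2} \<and> length z = n}"
  by (rule inj_on_inverseI[where g = "\<lambda>i. sumf (fst i) (snd i)"]) (simp add: sumf_sum_inputs)

lemma finite_ternary_inputs: "finite (ternary_inputs n)"
  unfolding ternary_inputs_def by (intro finite_imageI finite_lists_length_eq) simp

lemma card_ternary_inputs: "card (ternary_inputs n) = 3 ^ n"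
  unfolding ternary_inputs_def card_image[OF inj_on_sum_inputs]
  by (subst card_lists_length_eq) (simp_all add: numeral_3_eq_3)

lemma ternary_inputs_words: "ternary_inputs n \<subseteq> words n \<times> words n"
  by (auto simp: ternary_inputs_def sum_inputs_def words_def)

lemma ternary_inputs_fibre:
  assumes "i \<in> ternary_inputs n"
  shows "{j \<in> ternary_inputs n. sumf (fst j) (snd j) = sumf (fst i) (snd i)} = {i}"
  using assms by (auto simp: ternary_inputs_def sumf_sum_inputs)

lemma card_words_square: "card (words n \<times> words n) = 4 ^ n"
  by (simp add: card_cartesian_product card_words power_mult_distrib[symmetric])

text \<open>Complementing the second word exchanges agreements and disagreements, so the mean
  Hamming distance of two words is half their length.\<close>

lemma hamming_sum:
  "(\<Sum>i\<in>words n \<times> words n. real (card {j. j < n \<and> fst i ! j \<noteq> snd i ! j})) = n / 2 * 4 ^ n"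
proof -
  let ?W = "words n \<times> words n"
  let ?d = "\<lambda>i. real (card {j. j < n \<and> fst i ! j \<noteq> snd i ! j})"
  let ?e = "\<lambda>i. real (card {j. j < n \<and> fst i ! j = snd i ! j})"
  have "(\<Sum>i\<in>?W. ?d i) = (\<Sum>i\<in>?W. ?e i)"
  proof (rule sum.reindex_bij_witness[where i = "\<lambda>i. (fst i, map Not (snd i))" and j = "\<lambda>i. (fst i, map Not (snd i))"])
    fix i assume "i \<in> ?W"
    then have "length (snd i) = n" by (auto simp: words_def)
    then have "{j. j < n \<and> fst i ! j = map Not (snd i) ! j} = {j. j < n \<and> fst i ! j \<noteq> snd i ! j}"
      by auto
    then show "?e (fst i, map Not (snd i)) = ?d i" by simp
  qed (auto simp: words_def comp_def)
  moreover have "(\<Sum>i\<in>?W. ?d i) + (\<Sum>i\<in>?W. ?e i) = (\<Sum>i\<in>?W. real n)"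
    unfolding sum.distrib[symmetric]
  proof (rule sum.cong[OF refl])
    fix i :: "bool list \<times> bool list"
    have "card {j. j < n \<and> fst i ! j \<noteq> snd i ! j} + card {j. j < n \<and> fst i ! j = snd i ! j} =
        card ({j. j < n \<and> fst i ! j \<noteq> snd i ! j} \<union> {j. j < n \<and> fst i ! j = snd i ! j})"
      by (intro card_Un_disjoint[symmetric]) auto
    also have "{j. j < n \<and> fst i ! j \<noteq> snd i ! j} \<union> {j. j < n \<and> fst i ! j = snd i ! j} = {..<n}"
      by auto
    finally show "?d i + ?e i = real n" by (simp flip: of_nat_add)
  qed
  moreover have "(\<Sum>i\<in>?W. real n) = n * 4 ^ n"
    by (simp add: card_words_square)
  ultimately have "2 * (\<Sum>i\<in>?W. ?d i) = n * 4 ^ n" by linarith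
  then show ?thesis by simp
qed

text \<open>Where \<open>x\<close> and \<open>y\<close> agree the sum fixes both bits. Hence a pair
  with the same sum is known from the bits of its first word at the positions where they differ, and
  its second word follows by cancellation.\<close>

lemma card_sumf_fibre:
  assumes "x \<in> words n" "y \<in> words n"
  shows "card {i \<in> words n \<times> words n. sumf (fst i) (snd i) = sumf x y} \<le> 2 ^ card {j. j < n \<and> x ! j \<noteq> y ! j}"
proof -
  let ?S = "{j. j < n \<and> x ! j \<noteq> y ! j}"
  let ?F = "{i \<in> words n \<times> words n. sumf (fst i) (snd i) = sumf x y}"
  have nth: "of_bool (fst i ! j) + of_bool (snd i ! j) = (of_bool (x ! j) + of_bool (y ! j) :: nat)"
    if "i \<in> ?F" "j < n" for i j
  proof -
    have "sumf (fst i) (snd i) ! j = sumf x y ! j" using that by simp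
    moreover have "j < length (fst i)" "j < length (snd i)" "j < length x" "j < length y"
      using that assms by (auto simp: words_def)
    ultimately show ?thesis by (simp only: nth_sumf)
  qed
  have "inj_on (\<lambda>i. {j\<in>?S. fst i ! j}) ?F"
  proof (rule inj_onI)
    fix a b assume ab: "a \<in> ?F" "b \<in> ?F" and eq: "{j\<in>?S. fst a ! j} = {j\<in>?S. fst b ! j}"
    have len: "length (fst a) = n" "length (snd a) = n" "length (fst b) = n" "length (snd b) = n"
      using ab by (auto simp: words_def)
    have "fst a ! j = fst b ! j" if j: "j < n" for j
    proof (cases "j \<in> ?S")
      case True
      then show ?thesis using eq by blast
    next
      case False
      with j have "x ! j = y ! j" by simp
      then show ?thesis using nth[OF ab(1) j] nth[OF ab(2) j]
        by (cases "x ! j"; cases "fst a ! j"; cases "snd a ! j"; cases "fst b ! j"; cases "snd b ! j") simp_all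
    qed
    then have "fst a = fst b" using len by (intro nth_equalityI) auto
    moreover have "sumf (fst a) (snd a) = sumf (fst b) (snd b)" using ab by simp
    ultimately have "snd a = snd b" using len by (intro sumf_cancel_left[of "fst a"]) auto
    with \<open>fst a = fst b\<close> show "a = b" by (simp add: prod_eq_iff)
  qed
  then have "card ?F = card ((\<lambda>i. {j\<in>?S. fst i ! j}) ` ?F)" by (simp add: card_image)
  also have "\<dots> \<le> card (Pow ?S)" by (intro card_mono) auto
  also have "\<dots> = 2 ^ card ?S" by (simp add: card_Pow)
  finally show ?thesis .
qed

section \<open>Entropy bounds for transcripts and views\<close>

context secure_sum
begin

lemma mixture_support:
  assumes "finite I" "I \<noteq> {}" "I \<subseteq> words n \<times> words n" "m \<in> set_pmf (mixture I)"
  obtains x y where "(x, y) \<in> I" "x \<in> words n" "y \<in> words n" "m \<in> set_pmf (transcripts x y)"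
    "xof m = x" "yof m = y"
proof -
  obtain i where "i \<in> I" "m \<in> set_pmf (transcripts (fst i) (snd i))"
    using assms(4) assms(1,2) unfolding mixture_def by auto
  with assms(3) show ?thesis using that[of "fst i" "snd i"] xof_yof[of "fst i" "snd i" m] by auto
qed

lemma xof_determined:
  assumes "finite I" "I \<noteq> {}" "I \<subseteq> words n \<times> words n"
  shows "determines (mixture I) (\<lambda>m. (fst m, snd (snd m))) xof"
    and "determines (mixture I) (\<lambda>m. (fst m, fst (snd m))) yof"
    and "determines (mixture I) (\<lambda>m. (fst (snd m), snd (snd m))) (\<lambda>m. sumf (xof m) (yof m))"
proof -
  have *: "(fst v = fst w \<and> snd (snd v) = snd (snd w) \<longrightarrow> xof v = xof w) \<and>
      (fst v = fst w \<and> fst (snd v) = fst (snd w) \<longrightarrow> yof v = yof w) \<and>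
      (fst (snd v) = fst (snd w) \<and> snd (snd v) = snd (snd w) \<longrightarrow> sumf (xof v) (yof v) = sumf (xof w) (yof w))"
    if vm: "v \<in> set_pmf (mixture I)" and wm: "w \<in> set_pmf (mixture I)" for v w
  proof -
    obtain x y where v: "x \<in> words n" "y \<in> words n" "v \<in> set_pmf (transcripts x y)" "xof v = x" "yof v = y"
      using mixture_support[OF assms vm] by metis
    obtain x' y' where w: "x' \<in> words n" "y' \<in> words n" "w \<in> set_pmf (transcripts x' y')" "xof w = x'" "yof w = y'"
      using mixture_support[OF assms wm] by metis
    obtain a b c a' b' c' where vw: "v = (a, b, c)" "w = (a', b', c')" by (metis prod_cases3)
    show ?thesis
      using input_determined[OF v(1) w(1) v(2) w(2), of a b c b' c'] sum_determined[OF v(1) w(1) v(2) w(2), of a b c a'] v w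
      unfolding vw by auto
  qed
  show "determines (mixture I) (\<lambda>m. (fst m, snd (snd m))) xof"
    "determines (mixture I) (\<lambda>m. (fst m, fst (snd m))) yof"
    "determines (mixture I) (\<lambda>m. (fst (snd m), snd (snd m))) (\<lambda>m. sumf (xof m) (yof m))"
    by (rule determinesI; use * in blast)+
qed

lemma ternary_nonempty: "ternary_inputs n \<noteq> {}"
  using card_ternary_inputs[of n] by (metis card.empty power_not_zero zero_neq_numeral)

lemma cond_surprisal_mixture:
  assumes I: "finite I" "I \<noteq> {}" "I \<subseteq> words n \<times> words n"
    and B: "\<And>x y. x \<in> words n \<Longrightarrow> y \<in> words n \<Longrightarrow> map_pmf B (transcripts x y) = r"
    and card: "\<And>i. i \<in> I \<Longrightarrow> card {j\<in>I. G (fst j) (snd j) = G (fst i) (snd i)} = k"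
  shows "cond_entropy (mixture I) (\<lambda>m. G (xof m) (yof m)) B = ennreal (log 2 (card I / k))"
  unfolding mixture_def
proof (rule cond_entropy_const_value, rule cond_surprisal_uniform_inputs[where G = "\<lambda>i. G (fst i) (snd i)" and r = r])
  fix i m assume "i \<in> I" "m \<in> set_pmf (transcripts (fst i) (snd i))"
  then show "G (xof m) (yof m) = G (fst i) (snd i)"
    using I(3) xof_yof[of "fst i" "snd i" m] by auto
qed (use assms in auto)

text \<open>H(A) >= H(A|B) >= H(Z|B) = n log 3, where the last equality holds because
  \<open>B\<close> is independent of the inputs and the sum is uniform on ternary words.\<close>

lemma cond_entropy_ternary:
  assumes "\<And>x y. x \<in> words n \<Longrightarrow> y \<in> words n \<Longrightarrow> map_pmf B (transcripts x y) = r"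
    and "determines (mixture (ternary_inputs n)) (\<lambda>m. (A m, B m)) (\<lambda>m. sumf (xof m) (yof m))"
  shows "ennreal (n * log 2 3) \<le> ent (map_pmf A (mixture (ternary_inputs n)))"
proof -
  \<comment> \<open>Each of the \<open>3 ^ n\<close> sums has exactly one pair in
    \<open>ternary_inputs n\<close>, which gives fibre size 1.\<close>
  have "ennreal (n * log 2 3) = cond_entropy (mixture (ternary_inputs n)) (\<lambda>m. sumf (xof m) (yof m)) B"
    by (subst cond_surprisal_mixture[OF finite_ternary_inputs ternary_nonempty ternary_inputs_words assms(1), where G = sumf and k = 1])
       (simp_all add: ternary_inputs_fibre card_ternary_inputs log_nat_power)
  also have "\<dots> \<le> cond_entropy (mixture (ternary_inputs n)) A B"
    by (rule cond_entropy_mono) (rule assms(2))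
  also have "\<dots> \<le> cond_entropy (mixture (ternary_inputs n)) A (\<lambda>_. ())"
    by (rule cond_entropy_cond_le_determines) (simp add: determines_def)
  finally show ?thesis by (simp add: ent_map_pmf)
qed

lemma zero_word: "replicate n False \<in> words n"
  by (simp add: words_def)

lemma ent_M31: "ennreal (n * log 2 3) \<le> ent (map_pmf M31 (J P p))"
proof -
  define r where "r = map_pmf (\<lambda>m. snd (snd m)) (transcripts (replicate n False) (replicate n False))"
  have "map_pmf (\<lambda>m. snd (snd m)) (mixture (ternary_inputs n)) = r" "map_pmf M31 (J P p) = r"
    using map_mixture[OF finite_ternary_inputs ternary_nonempty ternary_inputs_words, where F = "\<lambda>a b c. c" and r = r]
      M31_law[OF _ zero_word _ zero_word] by (auto simp: r_def split_def)
  moreover have "ennreal (n * log 2 3) \<le> ent (map_pmf (\<lambda>m. snd (snd m)) (mixture (ternary_inputs n)))"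
    by (rule cond_entropy_ternary[where B = "\<lambda>m. fst (snd m)"])
       (rule M23_law[OF _ zero_word _ zero_word], assumption+,
        rule determines_trans[OF _ xof_determined(3)[OF finite_ternary_inputs ternary_nonempty ternary_inputs_words]],
        simp add: determines_def prod_eq_iff)
  ultimately show ?thesis by simp
qed

lemma ent_M23: "ennreal (n * log 2 3) \<le> ent (map_pmf M23 (J P p))"
proof -
  define r where "r = map_pmf (\<lambda>m. fst (snd m)) (transcripts (replicate n False) (replicate n False))"
  have "map_pmf (\<lambda>m. fst (snd m)) (mixture (ternary_inputs n)) = r" "map_pmf M23 (J P p) = r"
    using map_mixture[OF finite_ternary_inputs ternary_nonempty ternary_inputs_words, where F = "\<lambda>a b c. b" and r = r]
      M23_law[OF _ zero_word _ zero_word] by (auto simp: r_def split_def)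
  moreover have "ennreal (n * log 2 3) \<le> ent (map_pmf (\<lambda>m. fst (snd m)) (mixture (ternary_inputs n)))"
    by (rule cond_entropy_ternary[where B = "\<lambda>m. snd (snd m)"])
       (rule M31_law[OF _ zero_word _ zero_word], assumption+,
        rule xof_determined(3)[OF finite_ternary_inputs ternary_nonempty ternary_inputs_words])
  ultimately show ?thesis by simp
qed

definition \<nu> :: "(bool list \<times> bool list \<times> bool list) pmf" where
  "\<nu> = mixture (words n \<times> words n)"

lemma words2: "finite (words n \<times> words n)" "words n \<times> words n \<noteq> {}" "words n \<times> words n \<subseteq> words n \<times> words n"
  by (auto simp: finite_words words_nonempty)

lemma finished3_\<nu>: "m \<in> set_pmf \<nu> \<Longrightarrow> finished3 m"
  unfolding \<nu>_def using mixture_support[OF words2] terminating_run.transcripts_finished[OF run] by metis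

lemma map_parse3_\<nu>: "map_pmf (parse3 t) \<nu> = bind_pmf (pmf_of_set (words n \<times> words n)) (\<lambda>(x, y). state P x y t)"
  unfolding \<nu>_def mixture_def map_bind_pmf
proof (rule bind_pmf_cong[OF refl])
  fix i assume "i \<in> set_pmf (pmf_of_set (words n \<times> words n))"
  then have "fst i \<in> words n" "snd i \<in> words n" using words2 by auto
  then show "map_pmf (parse3 t) (transcripts (fst i) (snd i)) = (case i of (x, y) \<Rightarrow> state P x y t)"
    using terminating_run.map_parse_transcripts[OF run, of "fst i" "snd i" t] by (cases i) simp
qed

text \<open>The histories decoded by \<open>parse\<close> serve as approximations: jointly they have
  the law of the state after \<open>t\<close> rounds, where the interaction inequality is known, and
  they eventually identify the final transcripts.\<close>

lemma interact_\<nu>: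
  assumes "cond_entropy \<nu> fst (\<lambda>_. ()) \<noteq> \<infinity>"
  shows "cond_entropy \<nu> fst (\<lambda>m. snd (snd m)) + cond_entropy \<nu> fst (\<lambda>m. fst (snd m))
    \<le> cond_entropy \<nu> fst (\<lambda>m. (fst (snd m), snd (snd m))) + cond_entropy \<nu> fst (\<lambda>_. ())"
proof (rule cond_entropy_interact_limit[OF _ _ _ _ _ _ _ _ _ assms,
    where A' = "\<lambda>t m. parse (cA2B P) (cB2A P) t (fst m)"
      and B' = "\<lambda>t m. parse (cB2C P) (cC2B P) t (fst (snd m))"
      and C' = "\<lambda>t m. parse (cC2A P) (cA2C P) t (snd (snd m))"])
  have fin: "finished (cA2B P) (cB2A P) (fst m)" "finished (cB2C P) (cC2B P) (fst (snd m))"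
    "finished (cC2A P) (cA2C P) (snd (snd m))" if "m \<in> set_pmf \<nu>" for m
    using finished3_\<nu>[OF that] by (auto simp: finished3_def split_def)
  show "nonneg_mean \<nu> (interact \<nu> (\<lambda>m. parse (cA2B P) (cB2A P) t (fst m))
      (\<lambda>m. parse (cB2C P) (cC2B P) t (fst (snd m))) (\<lambda>m. parse (cC2A P) (cA2C P) t (snd (snd m))))" for t
    using nonneg_mean_interact_map[OF nonneg_mean_interact_state[OF finite_words words_nonempty finite_words words_nonempty,
          of n n P t, folded map_parse3_\<nu>]]
    by (simp add: split_def)
  show "eventually_determines \<nu> (\<lambda>t m. parse (cA2B P) (cB2A P) t (fst m)) fst"
    unfolding eventually_determines_def
  proof
    fix w assume "w \<in> set_pmf \<nu>"
    from parse_eventually_injective[OF prefix_free_codes(1,2) fin(1)[OF this]]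
    show "\<forall>\<^sub>F t in sequentially. \<forall>v\<in>set_pmf \<nu>. parse (cA2B P) (cB2A P) t (fst v) = parse (cA2B P) (cB2A P) t (fst w) \<longrightarrow> fst v = fst w"
      by eventually_elim (use fin in blast)
  qed
  show "eventually_determines \<nu> (\<lambda>t m. parse (cB2C P) (cC2B P) t (fst (snd m))) (\<lambda>m. fst (snd m))"
    unfolding eventually_determines_def
  proof
    fix w assume "w \<in> set_pmf \<nu>"
    from parse_eventually_injective[OF prefix_free_codes(3,4) fin(2)[OF this]]
    show "\<forall>\<^sub>F t in sequentially. \<forall>v\<in>set_pmf \<nu>. parse (cB2C P) (cC2B P) t (fst (snd v)) = parse (cB2C P) (cC2B P) t (fst (snd w)) \<longrightarrow> fst (snd v) = fst (snd w)"
      by eventually_elim (use fin in blast)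
  qed
  show "eventually_determines \<nu> (\<lambda>t m. parse (cC2A P) (cA2C P) t (snd (snd m))) (\<lambda>m. snd (snd m))"
    unfolding eventually_determines_def
  proof
    fix w assume "w \<in> set_pmf \<nu>"
    from parse_eventually_injective[OF prefix_free_codes(5,6) fin(3)[OF this]]
    show "\<forall>\<^sub>F t in sequentially. \<forall>v\<in>set_pmf \<nu>. parse (cC2A P) (cA2C P) t (snd (snd v)) = parse (cC2A P) (cA2C P) t (snd (snd w)) \<longrightarrow> snd (snd v) = snd (snd w)"
      by eventually_elim (use fin in blast)
  qed
  show "determines \<nu> (\<lambda>m. parse (cB2C P) (cC2B P) s (fst (snd m))) (\<lambda>m. parse (cB2C P) (cC2B P) t (fst (snd m)))"
    if "t \<le> s" for s t
    by (rule determinesI) (use parse_parse[OF prefix_free_codes(3,4) fin(2) that] in metis)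
  show "determines \<nu> (\<lambda>m. parse (cC2A P) (cA2C P) s (snd (snd m))) (\<lambda>m. parse (cC2A P) (cA2C P) t (snd (snd m)))"
    if "t \<le> s" for s t
    by (rule determinesI) (use parse_parse[OF prefix_free_codes(5,6) fin(3) that] in metis)
qed (auto intro: determinesI)

text \<open>Given the sum, at most 2^d input pairs remain, with d the Hamming distance of the
  inputs; the mean of d is n/2.\<close>

lemma cond_entropy_input_given_sum: "cond_entropy \<nu> xof (\<lambda>m. sumf (xof m) (yof m)) \<le> ennreal (n / 2)"
proof -
  let ?d = "\<lambda>i. real (card {j. j < n \<and> fst i ! j \<noteq> snd i ! j})"
  let ?W = "words n \<times> words n"
  have "cond_surprisal \<nu> xof (\<lambda>m. sumf (xof m) (yof m)) m \<le> ?d (xof m, yof m)" if m: "m \<in> set_pmf \<nu>" for m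
  proof -
    obtain x y where xy: "x \<in> words n" "y \<in> words n" "m \<in> set_pmf (transcripts x y)" "xof m = x" "yof m = y"
      using mixture_support[OF words2 m[unfolded \<nu>_def]] by metis
    have prob: "measure_pmf.prob (transcripts (fst i) (snd i)) {v. Q (xof v) (yof v)} = of_bool (Q (fst i) (snd i))"
      if "i \<in> ?W" for i Q
    proof -
      have "measure_pmf.prob (transcripts (fst i) (snd i)) {v. Q (xof v) (yof v)} =
          measure_pmf.prob (transcripts (fst i) (snd i)) {v. Q (fst i) (snd i)}"
        by (rule prob_cong_support) (use xof_yof[of "fst i" "snd i"] that in auto)
      then show ?thesis by simp
    qed
    have \<nu>: "measure_pmf.prob \<nu> {v. Q (xof v) (yof v)} = card {i\<in>?W. Q (fst i) (snd i)} / 4 ^ n" for Q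
      unfolding \<nu>_def mixture_def prob_uniform_inputs[OF words2(1,2)] card_words_square
      using words2(1) by (simp add: prob sum.If_cases Int_def of_bool_def)
    define a where "a = card {i\<in>?W. sumf (fst i) (snd i) = sumf x y}"
    define b where "b = card {i\<in>?W. fst i = x \<and> sumf (fst i) (snd i) = sumf x y}"
    have 1: "atom \<nu> (\<lambda>m. sumf (xof m) (yof m)) m = a / 4 ^ n"
      using \<nu>[of "\<lambda>x' y'. sumf x' y' = sumf x y"] by (simp add: atom_def xy a_def)
    have 2: "atom \<nu> (\<lambda>m. (xof m, sumf (xof m) (yof m))) m = b / 4 ^ n"
      using \<nu>[of "\<lambda>x' y'. x' = x \<and> sumf x' y' = sumf x y"] by (simp add: atom_def xy b_def)
    have "0 < b" unfolding b_def using xy finite_words by (subst card_gt_0_iff) auto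
    have "0 < a" using atom_pos[OF m, of "\<lambda>m. sumf (xof m) (yof m)"]
      by (simp add: 1 zero_less_divide_iff)
    have "cond_surprisal \<nu> xof (\<lambda>m. sumf (xof m) (yof m)) m = log 2 a - log 2 b"
      using \<open>0 < a\<close> \<open>0 < b\<close> by (simp add: cond_surprisal_def surprisal_def 1 2 log_divide)
    also have "\<dots> \<le> log 2 a" using \<open>0 < b\<close> by simp
    also have "\<dots> \<le> log 2 (2 ^ card {j. j < n \<and> x ! j \<noteq> y ! j})"
    proof -
      have "real a \<le> real (2 ^ card {j. j < n \<and> x ! j \<noteq> y ! j})"
        using card_sumf_fibre[OF xy(1,2)] unfolding a_def of_nat_le_iff .
      then show ?thesis using \<open>0 < a\<close> by (subst log_le_cancel_iff) simp_all
    qed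
    finally show ?thesis by (simp add: xy log_nat_power)
  qed
  then have "cond_entropy \<nu> xof (\<lambda>m. sumf (xof m) (yof m)) \<le> (\<integral>\<^sup>+ m. ennreal (?d (xof m, yof m)) \<partial>measure_pmf \<nu>)"
    by (rule cond_entropy_mono_point)
  also have "\<dots> = (\<Sum>i\<in>?W. \<integral>\<^sup>+ m. ennreal (?d (xof m, yof m)) \<partial>measure_pmf (transcripts (fst i) (snd i))) / card ?W"
    unfolding \<nu>_def mixture_def by (simp add: nn_integral_pmf_of_set[OF words2(2,1)])
  also have "(\<Sum>i\<in>?W. \<integral>\<^sup>+ m. ennreal (?d (xof m, yof m)) \<partial>measure_pmf (transcripts (fst i) (snd i))) =
      (\<Sum>i\<in>?W. ennreal (?d i))"
  proof (rule sum.cong[OF refl])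
    fix i assume "i \<in> ?W"
    then have "(\<integral>\<^sup>+ m. ennreal (?d (xof m, yof m)) \<partial>measure_pmf (transcripts (fst i) (snd i))) =
        (\<integral>\<^sup>+ m. ennreal (?d i) \<partial>measure_pmf (transcripts (fst i) (snd i)))"
      using xof_yof[of "fst i" "snd i"] by (intro nn_integral_cong_AE) (auto simp: AE_measure_pmf_iff)
    then show "(\<integral>\<^sup>+ m. ennreal (?d (xof m, yof m)) \<partial>measure_pmf (transcripts (fst i) (snd i))) = ennreal (?d i)"
      by (simp add: measure_pmf.emeasure_space_1)
  qed
  also have "\<dots> = ennreal (n / 2 * 4 ^ n)"
    by (subst sum_ennreal) (simp_all only: hamming_sum of_nat_0_le_iff)
  also have "\<dots> / card ?W = ennreal (n / 2 * 4 ^ n / 4 ^ n)"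
    unfolding card_words_square by (subst divide_ennreal[symmetric]) (simp_all flip: ennreal_power)
  also have "\<dots> = ennreal (n / 2)" by simp
  finally show ?thesis .
qed

lemma ent_M12: "ennreal (3 / 2 * n) \<le> ent (map_pmf M12 (J P p))"
proof -
  have M12: "map_pmf fst \<nu> = map_pmf M12 (J P p)"
    using map_mixture[OF words2, where F = "\<lambda>a b c. a" and r = "map_pmf fst (transcripts (replicate n False) (replicate n False))"]
      M12_law[OF _ zero_word _ zero_word] by (auto simp: \<nu>_def split_def)
  have fibre: "card {j \<in> words n \<times> words n. fst j = fst i} = 2 ^ n" "card {j \<in> words n \<times> words n. snd j = snd i} = 2 ^ n"
    if "i \<in> words n \<times> words n" for i
  proof -
    have "{j \<in> words n \<times> words n. fst j = fst i} = {fst i} \<times> words n" "{j \<in> words n \<times> words n. snd j = snd i} = words n \<times> {snd i}"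
      using that by auto
    then show "card {j \<in> words n \<times> words n. fst j = fst i} = 2 ^ n" "card {j \<in> words n \<times> words n. snd j = snd i} = 2 ^ n"
      by (simp_all add: card_cartesian_product card_words)
  qed
  \<comment> \<open>Of the \<open>4 ^ n\<close> input pairs, \<open>2 ^ n\<close> share a given
    input of one party, so that input carries n bits given an independent transcript.\<close>
  have log: "log 2 (4 ^ n / 2 ^ n) = n"
    by (simp add: power_divide[symmetric] log_nat_power)
  have X: "cond_entropy \<nu> xof (\<lambda>m. snd (snd m)) = ennreal n"
    using cond_surprisal_mixture[OF words2 M31_law[OF _ zero_word _ zero_word], of "\<lambda>x y. x" "2 ^ n"] fibre(1)
    by (simp add: card_words_square log \<nu>_def)
  have Y: "cond_entropy \<nu> yof (\<lambda>m. fst (snd m)) = ennreal n"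
    using cond_surprisal_mixture[OF words2 M23_law[OF _ zero_word _ zero_word], of "\<lambda>x y. y" "2 ^ n"] fibre(2)
    by (simp add: card_words_square log \<nu>_def)
  show ?thesis
  \<comment> \<open>Infinite entropy satisfies the bound at once; finiteness is what the limit and
    the cancellation rely on.\<close>
  proof (cases "cond_entropy \<nu> fst (\<lambda>_. ()) = \<infinity>")
    case True
    then show ?thesis by (simp flip: M12 add: ent_map_pmf)
  next
    case False
    have "ennreal (3 / 2 * n) \<le> cond_entropy \<nu> fst (\<lambda>_. ())"
      by (rule entropy_bound_from_interact[OF interact_\<nu>[OF False] xof_determined[OF words2, folded \<nu>_def] X Y cond_entropy_input_given_sum False])
    then show ?thesis by (simp flip: M12 add: ent_map_pmf)
  qed
qed

text \<open>\<open>M31\<close> is part of the views, and its law given any input pair is its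
  unconditional law; so its entropy bound holds in each conditional law and hence on
  average.\<close>

lemma cond_ent_views:
  "ennreal (n * log 2 3) \<le> cond_ent (J P p) (\<lambda>w. (V1 w, V2 w, V3 w)) (\<lambda>w. (RX w, RY w))"
proof -
  let ?V = "\<lambda>w. (V1 w, V2 w, V3 w)"
  have prob: "measure_pmf.prob (J P p) {w. (RX w, RY w) = b} = pmf p b" for b
    using prob_J[of P p "\<lambda>_. ()" "()" b] by (simp add: RX_def RY_def)
  have ent: "ennreal (n * log 2 3) \<le> ent (map_pmf ?V (cond_pmf (J P p) {w. (RX w, RY w) = b}))"
    if b: "b \<in> set_pmf p" for b
  proof -
    obtain x y where xy: "b = (x, y)" "x \<in> words n" "y \<in> words n" using b supp by auto
    let ?S = "{w. (RX w, RY w) = b}"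
    have pos: "0 < pmf p b" using b by (simp add: pmf_positive)
    have ne: "set_pmf (J P p) \<inter> ?S \<noteq> {}"
      using pos prob[of b] measure_pmf_zero_iff[of "J P p" ?S] by (metis less_irrefl)
    have "map_pmf M31 (cond_pmf (J P p) ?S) = map_pmf (\<lambda>(m12, m23, m31). m31) (transcripts x y)"
    proof (rule pmf_eqI)
      fix c
      have "pmf (map_pmf M31 (cond_pmf (J P p) ?S)) c =
          measure_pmf.prob (J P p) {w. fst (snd (snd (snd w))) = c \<and> fst w = b} / pmf p b"
        unfolding pmf_map_eq_prob prob_cond_pmf[OF ne] prob
        by (rule arg_cong2[where f = "(/)"], rule prob_cong_support) (auto simp: M31_def RX_def RY_def)
      also have "\<dots> = pmf (map_pmf (\<lambda>r. fst (snd (snd r))) (out P x y)) c"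
        using pos by (subst prob_J) (simp add: xy pmf_map_eq_prob)
      finally show "pmf (map_pmf M31 (cond_pmf (J P p) ?S)) c = pmf (map_pmf (\<lambda>(m12, m23, m31). m31) (transcripts x y)) c"
        using map_out[OF xy(2,3), of "\<lambda>a b c. c"] by simp
    qed
    also have "\<dots> = map_pmf M31 (J P p)"
      using map_mixture(2)[OF words2, where F = "\<lambda>a b c. c" and r = "map_pmf (\<lambda>(m12, m23, m31). m31) (transcripts x y)"]
        M31_law[OF _ xy(2) _ xy(3)] by (auto simp: split_def)
    finally have "ennreal (n * log 2 3) \<le> ent (map_pmf M31 (cond_pmf (J P p) ?S))"
      using ent_M31 by simp
    also have "\<dots> \<le> ent (map_pmf ?V (cond_pmf (J P p) ?S))"
      unfolding ent_map_pmf
      by (rule cond_entropy_mono) (auto simp: determines_def V1_def)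
    finally show ?thesis .
  qed
  have "ennreal (n * log 2 3) = (\<integral>\<^sup>+ b. ennreal (pmf p b) * ennreal (n * log 2 3) \<partial>count_space UNIV)"
    by (subst nn_integral_multc) (use measure_pmf.emeasure_space_1[of p] in \<open>simp_all add: nn_integral_pmf\<close>)
  also have "\<dots> \<le> cond_ent (J P p) ?V (\<lambda>w. (RX w, RY w))"
    unfolding cond_ent_def prob
  proof (rule nn_integral_mono)
    \<comment> \<open>Outside the support of \<open>p\<close> the weight is 0, so the conditional
      law there has no influence.\<close>
    fix b
    show "ennreal (pmf p b) * ennreal (n * log 2 3) \<le> ennreal (pmf p b) * ent (map_pmf ?V (cond_pmf (J P p) {w. (RX w, RY w) = b}))"
      using ent[of b] by (cases "b \<in> set_pmf p") (auto intro: mult_left_mono simp: set_pmf_iff)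
  qed
  finally show ?thesis .
qed

end

theorem theorem14:
  fixes n :: nat and p :: "(bool list \<times> bool list) pmf"
  assumes "n \<ge> 1"
    and "set_pmf p = {(x, y). length x = n \<and> length y = n}"
  shows "(\<forall>P :: (bool list, bool list, nat list) protocol. secure P p sumf \<longrightarrow>
            ent (map_pmf M31 (J P p)) \<ge> ennreal (real n * log 2 3) \<and>
            ent (map_pmf M23 (J P p)) \<ge> ennreal (real n * log 2 3) \<and>
            ent (map_pmf M12 (J P p)) \<ge> ennreal (3 / 2 * real n))
         \<and> rho p sumf \<ge> ennreal (real n * log 2 3)"
proof -
  have sec: "secure_sum n p P" if "secure P p sumf" for P :: "(bool list, bool list, nat list) protocol"
    by unfold_locales (use that assms(2) in \<open>auto simp: words_def\<close>)
  have "rho p sumf \<ge> ennreal (real n * log 2 3)"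
    unfolding rho_def
    by (rule INF_greatest) (use sec secure_sum.cond_ent_views in blast)
  then show ?thesis
    using sec secure_sum.ent_M31 secure_sum.ent_M23 secure_sum.ent_M12 by blast
qed

end
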